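(* Assume the Bounded Min-Plus Product Hypothesis. Then for every constant $\gamma\in[0,1]$, with $d=n^\gamma\ge 2$, APSP on $n$-node (directed or undirected) graphs whose edge weights take at most $d$ distinct values — and hence also $d$-Weights APSP — cannot be solved in time $O(\sqrt d\, n^{2.5-\epsilon})$ for any constant $\epsilon>0$.
   Context: Model: word-RAM with $O(\log n)$-bit words, integer weights polynomially bounded in $n$. For integers, the $(n_1,n_2,n_3\mid U)$-Min-Plus Product problem is: given an $n_1\times n_2$ integer matrix $A$ and an $n_2\times n_3$ integer matrix $B$ with all entries bounded by $U$ in absolute value, compute $C[i,j]=\min_k (A[i,k]+B[k,j])$. Bounded Min-Plus Product Hypothesis: for every $\gamma\in[1/2,1]$, $(n,n^\gamma,n\mid n^\gamma)$-Min-Plus Product cannot be solved in time $O(n^{2+\gamma-\epsilon})$ for any constant $\epsilon>0$. $d$-Weights APSP: given a directed edge-weighted $n$-node graph in which each node's outgoing edges carry at most $d$ distinct weights, compute all pairwise distances. *)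

theory Defs
  imports
    Complex_Main
    "HOL-Library.Extended_Real"
    "Jordan_Normal_Form.Matrix"
    "Graph_Theory.Pair_Digraph"
    "Graph_Theory.Shortest_Path"
begin

section \<open>Word-RAM\<close>

text \<open>
  A deterministic unit-cost RAM with a fixed number of registers (those occurring in the program)
  and an indirectly addressed memory. Control flow is structured rather than by jumps; the two
  simulate each other with constant-factor overhead.

  Every value produced must lie strictly between \<open>-W\<close> and \<open>W\<close>, where \<open>W\<close> is the word bound, and
  an overflowing instruction gets stuck. Running times below only count runs that terminate
  without getting stuck, with \<open>W = (n + 2) ^ c\<close> for a constant \<open>c\<close> that may depend on the program,
  that is, with words of \<open>O(log n)\<close> bits. (Wrap-around arithmetic is obtained by doubling \<open>c\<close> and
  reducing explicitly.)
\<close>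

type_synonym reg = nat

datatype binop = Add | Sub | Mul | Div | Mod | BitAnd | BitOr | BitXor | ShiftL | ShiftR

fun eval_binop :: "binop \<Rightarrow> int \<Rightarrow> int \<Rightarrow> int" where
  "eval_binop Add x y = x + y"
| "eval_binop Sub x y = x - y"
| "eval_binop Mul x y = x * y"
| "eval_binop Div x y = x div y"
| "eval_binop Mod x y = x mod y"
| "eval_binop BitAnd x y = and x y"
| "eval_binop BitOr x y = or x y"
| "eval_binop BitXor x y = xor x y"
| "eval_binop ShiftL x y = push_bit (nat y) x"
| "eval_binop ShiftR x y = drop_bit (nat y) x"

datatype test = Less reg reg | Equal reg reg

datatype com =
    Skip
  | Const reg int
  | Op binop reg reg reg
  | Load reg reg
  | Store reg reg
  | Seq com com
  | If test com com
  | While test com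

record state =
  regs :: "reg \<Rightarrow> int"
  mem :: "nat \<Rightarrow> int"

fun eval_test :: "test \<Rightarrow> state \<Rightarrow> bool" where
  "eval_test (Less a b) s \<longleftrightarrow> regs s a < regs s b"
| "eval_test (Equal a b) s \<longleftrightarrow> regs s a = regs s b"

text \<open>\<open>exec W P s t s'\<close>: started in \<open>s\<close>, the program \<open>P\<close> halts in \<open>s'\<close> after exactly \<open>t\<close> steps.\<close>

inductive exec :: "int \<Rightarrow> com \<Rightarrow> state \<Rightarrow> nat \<Rightarrow> state \<Rightarrow> bool" for W :: int where
  Skip: "exec W Skip s 1 s"
| Const: "\<bar>v\<bar> < W \<Longrightarrow> exec W (Const r v) s 1 (s\<lparr>regs := (regs s)(r := v)\<rparr>)"
| Op: "v = eval_binop f (regs s a) (regs s b) \<Longrightarrow> \<bar>v\<bar> < W \<Longrightarrow>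
    exec W (Op f r a b) s 1 (s\<lparr>regs := (regs s)(r := v)\<rparr>)"
| Load: "0 \<le> regs s a \<Longrightarrow> v = mem s (nat (regs s a)) \<Longrightarrow> \<bar>v\<bar> < W \<Longrightarrow>
    exec W (Load r a) s 1 (s\<lparr>regs := (regs s)(r := v)\<rparr>)"
| Store: "0 \<le> regs s a \<Longrightarrow>
    exec W (Store a r) s 1 (s\<lparr>mem := (mem s)(nat (regs s a) := regs s r)\<rparr>)"
| Seq: "exec W P s t s' \<Longrightarrow> exec W Q s' t' s'' \<Longrightarrow> exec W (Seq P Q) s (t + t') s''"
| IfTrue: "eval_test b s \<Longrightarrow> exec W P s t s' \<Longrightarrow> exec W (If b P Q) s (Suc t) s'"
| IfFalse: "\<not> eval_test b s \<Longrightarrow> exec W Q s t s' \<Longrightarrow> exec W (If b P Q) s (Suc t) s'"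
| WhileFalse: "\<not> eval_test b s \<Longrightarrow> exec W (While b P) s 1 s"
| WhileTrue: "eval_test b s \<Longrightarrow> exec W P s t s' \<Longrightarrow> exec W (While b P) s' t' s'' \<Longrightarrow>
    exec W (While b P) s (Suc (t + t')) s''"

lemma exec_deterministic:
  "exec W P s t s' \<Longrightarrow> exec W P s u s'' \<Longrightarrow> u = t \<and> s'' = s'"
proof (induction arbitrary: u s'' rule: exec.induct)
  case (Seq P s t s' Q t' s3)
  from Seq.prems show ?case by (cases rule: exec.cases) (use Seq.IH in blast)+
next
  case (WhileTrue b s P t s' t' s3)
  from WhileTrue.prems show ?case
    by (cases rule: exec.cases) (use WhileTrue.hyps WhileTrue.IH in blast)+
qed (erule exec.cases; auto)+

definition init_state :: "int list \<Rightarrow> state" where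
  "init_state xs = \<lparr>regs = (\<lambda>_. 0), mem = (\<lambda>a. if a < length xs then xs ! a else 0)\<rparr>"

text \<open>
  A problem is given by its instances of size \<open>n\<close>, the encoding of an instance as the initial
  memory contents, and the predicate saying that the final memory holds a correct answer.
\<close>

definition solvable_in_time ::
  "(nat \<Rightarrow> 'a set) \<Rightarrow> ('a \<Rightarrow> int list) \<Rightarrow> ('a \<Rightarrow> (nat \<Rightarrow> int) \<Rightarrow> bool) \<Rightarrow> (nat \<Rightarrow> real) \<Rightarrow> bool"
where
  "solvable_in_time inst inp correct T \<longleftrightarrow>
    (\<exists>P c. \<exists>C::real. \<forall>n\<ge>1. \<forall>x\<in>inst n. \<exists>t s.
      exec ((int n + 2) ^ c) P (init_state (inp x)) t s \<and>
      real t \<le> C * T n \<and> correct x (mem s))"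

section \<open>Min-plus product\<close>

definition min_plus_product :: "int mat \<Rightarrow> int mat \<Rightarrow> int mat" where
  "min_plus_product A B = mat (dim_row A) (dim_col B)
     (\<lambda>(i, j). Min ((\<lambda>k. A $$ (i, k) + B $$ (k, j)) ` {..<dim_col A}))"

definition min_plus_instances :: "nat \<Rightarrow> nat \<Rightarrow> nat \<Rightarrow> real \<Rightarrow> (int mat \<times> int mat) set" where
  "min_plus_instances n1 n2 n3 U = {(A, B).
     A \<in> carrier_mat n1 n2 \<and> B \<in> carrier_mat n2 n3 \<and>
     (\<forall>i<n1. \<forall>k<n2. real_of_int \<bar>A $$ (i, k)\<bar> \<le> U) \<and>
     (\<forall>k<n2. \<forall>j<n3. real_of_int \<bar>B $$ (k, j)\<bar> \<le> U)}"

definition row_major :: "int mat \<Rightarrow> int list" where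
  "row_major A = concat (map (\<lambda>i. map (\<lambda>j. A $$ (i, j)) [0..<dim_col A]) [0..<dim_row A])"

fun min_plus_input :: "int mat \<times> int mat \<Rightarrow> int list" where
  "min_plus_input (A, B) =
     [int (dim_row A), int (dim_col A), int (dim_col B)] @ row_major A @ row_major B"

fun min_plus_correct :: "int mat \<times> int mat \<Rightarrow> (nat \<Rightarrow> int) \<Rightarrow> bool" where
  "min_plus_correct (A, B) M \<longleftrightarrow> (\<forall>i<dim_row A. \<forall>j<dim_col B.
     M (i * dim_col B + j) = min_plus_product A B $$ (i, j))"

definition bounded_min_plus_hypothesis :: bool where
  "bounded_min_plus_hypothesis \<longleftrightarrow>
    (\<forall>\<gamma>\<in>{1/2..1::real}. \<forall>\<epsilon>>0.
      \<not> solvable_in_time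
          (\<lambda>n. min_plus_instances n (nat \<lfloor>real n powr \<gamma>\<rfloor>) n (real n powr \<gamma>))
          min_plus_input min_plus_correct
          (\<lambda>n. real n powr (2 + \<gamma> - \<epsilon>)))"

section \<open>All-pairs shortest paths\<close>

type_synonym wgraph = "nat pair_pre_digraph \<times> (nat \<times> nat \<Rightarrow> int)"

abbreviation distance :: "nat pair_pre_digraph \<Rightarrow> (nat \<times> nat \<Rightarrow> int) \<Rightarrow> nat \<Rightarrow> nat \<Rightarrow> ereal" where
  "distance G w u v \<equiv> wf_digraph.\<mu> (with_proj G) (\<lambda>e. real_of_int (w e)) u v"

definition no_negative_cycle :: "nat pair_pre_digraph \<Rightarrow> (nat \<times> nat \<Rightarrow> int) \<Rightarrow> bool" where
  "no_negative_cycle G w \<longleftrightarrow>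
    (\<forall>u p. pre_digraph.awalk (with_proj G) u p u \<longrightarrow>
       0 \<le> wf_digraph.awalk_cost (\<lambda>e. real_of_int (w e)) p)"

definition directed_graphs :: "nat \<Rightarrow> wgraph set" where
  "directed_graphs n = {(G, w). pair_digraph G \<and> pverts G = {..<n} \<and> no_negative_cycle G w}"

text \<open>An undirected edge is a pair of opposite arcs of equal weight.\<close>

definition undirected_graphs :: "nat \<Rightarrow> wgraph set" where
  "undirected_graphs n = {(G, w) \<in> directed_graphs n.
     pair_graph G \<and> (\<forall>(u, v)\<in>parcs G. w (u, v) = w (v, u))}"

definition few_weights :: "real \<Rightarrow> wgraph set" where
  "few_weights d = {(G, w). real (card (w ` parcs G)) \<le> d}"

definition few_weights_per_node :: "real \<Rightarrow> wgraph set" where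
  "few_weights_per_node d =
     {(G, w). \<forall>u\<in>pverts G. real (card (w ` out_arcs (with_proj G) u)) \<le> d}"

text \<open>
  The input is the number of nodes followed by the weighted adjacency matrix, the output is the
  distance matrix. An entry takes two words: \<open>1, x\<close> for the number \<open>x\<close>, and \<open>0, _\<close> for a missing
  arc or an infinite distance.
\<close>

fun apsp_input :: "wgraph \<Rightarrow> int list" where
  "apsp_input (G, w) = (let n = card (pverts G) in
     int n # concat (map (\<lambda>u. concat (map (\<lambda>v.
       if (u, v) \<in> parcs G then [1, w (u, v)] else [0, 0]) [0..<n])) [0..<n]))"

definition decode_distance :: "int \<Rightarrow> int \<Rightarrow> ereal \<Rightarrow> bool" where
  "decode_distance b x \<delta> \<longleftrightarrow>
     b = 1 \<and> \<delta> = ereal (real_of_int x) \<or> b = 0 \<and> \<delta> = \<infinity>"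

fun apsp_correct :: "wgraph \<Rightarrow> (nat \<Rightarrow> int) \<Rightarrow> bool" where
  "apsp_correct (G, w) M \<longleftrightarrow> (let n = card (pverts G) in
     \<forall>u<n. \<forall>v<n.
       decode_distance (M (2 * (u * n + v))) (M (2 * (u * n + v) + 1)) (distance G w u v))"

text \<open>
  Weights are polynomially bounded: for every constant \<open>c\<close> there must be an algorithm for weights
  of absolute value at most \<open>n ^ c\<close>.
\<close>

definition apsp_solvable_in_time :: "(nat \<Rightarrow> wgraph set) \<Rightarrow> (nat \<Rightarrow> real) \<Rightarrow> bool" where
  "apsp_solvable_in_time \<G> T \<longleftrightarrow>
    (\<forall>c. solvable_in_time
       (\<lambda>n. {(G, w) \<in> \<G> n. \<forall>e\<in>parcs G. \<bar>w e\<bar> \<le> int n ^ c}) apsp_input apsp_correct T)"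

text \<open>
  The parameter \<open>d = n\<^sup>\<gamma> \<ge> 2\<close>. The maximum matters for \<open>\<gamma> = 0\<close>, where it gives \<open>d = 2\<close>;
  for \<open>\<gamma> > 0\<close> it affects only finitely many \<open>n\<close>.
\<close>

definition num_weights :: "real \<Rightarrow> nat \<Rightarrow> real" where
  "num_weights \<gamma> n = max 2 (real n powr \<gamma>)"

end

theory Submission
  imports Defs
begin

text \<open>
  With \<open>\<delta> = (1 + \<gamma>) / 2\<close>, a min-plus product with inner dimension \<open>K = n\<^sup>\<delta>\<close> and entries of
  size at most \<open>K\<close> is reduced to shortest paths in one undirected graph with \<open>O(n)\<close> vertices and
  at most \<open>D + 1 \<le> max 2 n\<^sup>\<gamma>\<close> distinct weights, where \<open>D\<close> is about \<open>K\<^sup>2 / n\<close>. Each inner index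
  \<open>k\<close> becomes a path with about \<open>2 * K / D\<close> edges of weight \<open>D\<close> on either side of its midpoint. An
  entry \<open>a * D + b\<close> with \<open>b < D\<close>, shifted to be nonnegative, becomes an edge of weight \<open>M + b\<close> to
  the vertex \<open>a\<close> steps away from the midpoint, rows attaching on one side and columns on the other.
  The offset \<open>M\<close> exceeds the length of a whole chain, so a shortest path from a row to a column uses
  only two such edges, hence runs along a single chain and costs \<open>2 * M\<close> plus the sum of the two
  entries. All chains together have \<open>O(K\<^sup>2 / D) = O(n)\<close> vertices. This graph lies in all three
  classes of the theorem, and the \<open>O(n\<^sup>2)\<close> overhead of the reduction is below \<open>n\<^bsup>2 + \<delta> - \<epsilon>\<^esup>\<close>
  for \<open>\<epsilon> \<le> 1 / 2 \<le> \<delta>\<close>.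
\<close>

section \<open>Timed execution on the word-RAM\<close>

definition runs :: "int \<Rightarrow> com \<Rightarrow> state \<Rightarrow> nat \<Rightarrow> (state \<Rightarrow> bool) \<Rightarrow> bool" where
  "runs W P s T Q \<longleftrightarrow> (\<exists>t s'. exec W P s t s' \<and> t \<le> T \<and> Q s')"

lemma runs_mono:
  assumes "runs W P s T Q" "T \<le> T'" "\<And>s'. Q s' \<Longrightarrow> Q' s'"
  shows "runs W P s T' Q'"
  using assms unfolding runs_def by (meson order_trans)

lemma runs_Skip: "Q s \<Longrightarrow> runs W Skip s 1 Q"
  unfolding runs_def by (blast intro: exec.Skip)

lemma runs_Const:
  "\<bar>v\<bar> < W \<Longrightarrow> Q (s\<lparr>regs := (regs s)(r := v)\<rparr>) \<Longrightarrow> runs W (Const r v) s 1 Q"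
  unfolding runs_def by (blast intro: exec.Const)

lemma runs_Op:
  assumes "\<bar>eval_binop f (regs s a) (regs s b)\<bar> < W"
    and "Q (s\<lparr>regs := (regs s)(r := eval_binop f (regs s a) (regs s b))\<rparr>)"
  shows "runs W (Op f r a b) s 1 Q"
  unfolding runs_def using assms by (blast intro: exec.Op)

lemma runs_Load:
  assumes "0 \<le> regs s a" "\<bar>mem s (nat (regs s a))\<bar> < W"
    and "Q (s\<lparr>regs := (regs s)(r := mem s (nat (regs s a)))\<rparr>)"
  shows "runs W (Load r a) s 1 Q"
  unfolding runs_def using assms by (blast intro: exec.Load)

lemma runs_Store:
  assumes "0 \<le> regs s a" "Q (s\<lparr>mem := (mem s)(nat (regs s a) := regs s r)\<rparr>)"
  shows "runs W (Store a r) s 1 Q"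
  unfolding runs_def using assms by (blast intro: exec.Store)

lemma runs_Seq:
  assumes "runs W P s T Q" "\<And>s'. Q s' \<Longrightarrow> runs W P' s' T' Q'"
  shows "runs W (Seq P P') s (T + T') Q'"
  using assms unfolding runs_def by (metis add_mono exec.Seq)

lemma runs_If:
  assumes "eval_test b s \<Longrightarrow> runs W P s T Q" "\<not> eval_test b s \<Longrightarrow> runs W P' s T Q"
  shows "runs W (If b P P') s (Suc T) Q"
proof (cases "eval_test b s")
  case True
  with assms(1) show ?thesis unfolding runs_def by (meson Suc_le_mono exec.IfTrue)
next
  case False
  with assms(2) show ?thesis unfolding runs_def by (meson Suc_le_mono exec.IfFalse)
qed

lemma runs_While:
  assumes "I 0 s"
    and step: "\<And>i s. i < m \<Longrightarrow> I i s \<Longrightarrow> eval_test b s \<and> runs W P s T (I (Suc i))"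
    and stop: "\<And>s. I m s \<Longrightarrow> \<not> eval_test b s"
  shows "runs W (While b P) s (m * Suc T + 1) (I m)"
proof -
  have "runs W (While b P) s (j * Suc T + 1) (I m)" if "I i s" "i + j = m" for i j s
    using that
  proof (induction j arbitrary: i s)
    case 0
    then show ?case
      using exec.WhileFalse[OF stop, of s] unfolding runs_def by force
  next
    case (Suc j)
    then obtain t s' where body: "exec W P s t s'" "t \<le> T" "I (Suc i) s'" and test: "eval_test b s"
      using step[of i s] unfolding runs_def by auto
    obtain t' s'' where rest: "exec W (While b P) s' t' s''" "t' \<le> j * Suc T + 1" "I m s''"
      using Suc.IH[of "Suc i" s'] body Suc.prems unfolding runs_def by auto
    have "exec W (While b P) s (Suc (t + t')) s''"
      using test body(1) rest(1) by (rule exec.WhileTrue)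
    moreover have "Suc (t + t') \<le> Suc j * Suc T + 1" using body(2) rest(2) by simp
    ultimately show ?case using rest(3) unfolding runs_def by blast
  qed
  from this[of 0 s m] assms(1) show ?thesis by simp
qed

lemma exec_word_bound_mono:
  assumes "exec W P s t s'" "W \<le> W'"
  shows "exec W' P s t s'"
  using assms by (induction rule: exec.induct) (metis exec.intros order.strict_trans2)+

lemma exec_word_bound_power:
  assumes "exec (v ^ c) P s t s'" "0 \<le> v" "v \<le> w ^ a" "1 \<le> w" "a * c \<le> e"
  shows "exec (w ^ e) P s t s'"
proof (rule exec_word_bound_mono[OF assms(1)])
  have "v ^ c \<le> (w ^ a) ^ c" using assms(2,3) by (intro power_mono)
  also have "\<dots> = w ^ (a * c)" by (simp add: power_mult)
  also have "\<dots> \<le> w ^ e" using assms(4,5) by (intro power_increasing)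
  finally show "v ^ c \<le> w ^ e" .
qed

fun test_regs :: "test \<Rightarrow> reg set" where
  "test_regs (Less a b) = {a, b}"
| "test_regs (Equal a b) = {a, b}"

fun com_regs :: "com \<Rightarrow> reg set" where
  "com_regs Skip = {}"
| "com_regs (Const r v) = {r}"
| "com_regs (Op f r a b) = {r, a, b}"
| "com_regs (Load r a) = {r, a}"
| "com_regs (Store a r) = {a, r}"
| "com_regs (Seq P Q) = com_regs P \<union> com_regs Q"
| "com_regs (If b P Q) = test_regs b \<union> com_regs P \<union> com_regs Q"
| "com_regs (While b P) = test_regs b \<union> com_regs P"

lemma finite_test_regs: "finite (test_regs b)"
  by (cases b) auto

lemma finite_com_regs: "finite (com_regs P)"
  by (induction P) (auto simp: finite_test_regs)

definition override_high_regs :: "reg \<Rightarrow> (reg \<Rightarrow> int) \<Rightarrow> state \<Rightarrow> state" where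
  "override_high_regs R h s = s\<lparr>regs := (\<lambda>r. if r < R then regs s r else h r)\<rparr>"

lemma override_high_regs_sel [simp]:
  "regs (override_high_regs R h s) r = (if r < R then regs s r else h r)"
  "mem (override_high_regs R h s) = mem s"
  by (simp_all add: override_high_regs_def)

lemma override_high_regs_upd:
  "r < R \<Longrightarrow> override_high_regs R h (s\<lparr>regs := (regs s)(r := v)\<rparr>) =
    (override_high_regs R h s)\<lparr>regs := (regs (override_high_regs R h s))(r := v)\<rparr>"
  "override_high_regs R h (s\<lparr>mem := M\<rparr>) = (override_high_regs R h s)\<lparr>mem := M\<rparr>"
  by (cases s; auto simp: override_high_regs_def)+

lemma eval_test_override_high_regs:
  "test_regs b \<subseteq> {..<R} \<Longrightarrow> eval_test b (override_high_regs R h s) = eval_test b s"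
  by (cases b) auto

lemma exec_override_high_regs:
  assumes "exec W P s t s'" "com_regs P \<subseteq> {..<R}"
  shows "exec W P (override_high_regs R h s) t (override_high_regs R h s')"
  using assms
proof (induction rule: exec.induct)
  case (Store s a r)
  then show ?case
    using exec.Store[of "override_high_regs R h s" a W r] by (simp add: override_high_regs_upd)
qed (auto intro!: exec.intros(1-4) intro: exec.intros(6-)
       simp: override_high_regs_upd eval_test_override_high_regs simp del: One_nat_def)

section \<open>A structured language with expressions and counted loops\<close>

record 'v store =
  vars :: "'v \<Rightarrow> int"
  heap :: "nat \<Rightarrow> int"

abbreviation assign :: "'v \<Rightarrow> int \<Rightarrow> 'v store \<Rightarrow> 'v store" where
  "assign x v \<sigma> \<equiv> \<sigma>\<lparr>vars := (vars \<sigma>)(x := v)\<rparr>"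

datatype 'v aexp = Num int | Var 'v | Bin binop "'v aexp" "'v aexp" | Mem "'v aexp"

fun aval :: "'v aexp \<Rightarrow> 'v store \<Rightarrow> int" where
  "aval (Num v) \<sigma> = v"
| "aval (Var x) \<sigma> = vars \<sigma> x"
| "aval (Bin f e e') \<sigma> = eval_binop f (aval e \<sigma>) (aval e' \<sigma>)"
| "aval (Mem e) \<sigma> = heap \<sigma> (nat (aval e \<sigma>))"

fun asafe :: "int \<Rightarrow> 'v aexp \<Rightarrow> 'v store \<Rightarrow> bool" where
  "asafe W (Num v) \<sigma> \<longleftrightarrow> \<bar>v\<bar> < W"
| "asafe W (Var x) \<sigma> \<longleftrightarrow> \<bar>vars \<sigma> x\<bar> < W"
| "asafe W (Bin f e e') \<sigma> \<longleftrightarrow>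
     asafe W e \<sigma> \<and> asafe W e' \<sigma> \<and> \<bar>eval_binop f (aval e \<sigma>) (aval e' \<sigma>)\<bar> < W"
| "asafe W (Mem e) \<sigma> \<longleftrightarrow> asafe W e \<sigma> \<and> 0 \<le> aval e \<sigma> \<and> \<bar>heap \<sigma> (nat (aval e \<sigma>))\<bar> < W"

datatype comparison = Lt | Eq

fun compare :: "comparison \<Rightarrow> int \<Rightarrow> int \<Rightarrow> bool" where
  "compare Lt x y \<longleftrightarrow> x < y"
| "compare Eq x y \<longleftrightarrow> x = y"

datatype 'v stm =
    Nop
  | Assign 'v "'v aexp"
  | Write "'v aexp" "'v aexp"
  | Comp "'v stm" "'v stm"
  | Cond comparison "'v aexp" "'v aexp" "'v stm" "'v stm"
  | For 'v "'v aexp" "'v stm"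

text \<open>
  Besides the postcondition, \<open>wp\<close> demands that all values stay within the word range and that no loop
  makes more than \<open>m\<close> iterations. Loop counters are kept outside the store, so that a body may
  overwrite the loop variable.
\<close>

fun wp :: "int \<Rightarrow> nat \<Rightarrow> 'v stm \<Rightarrow> ('v store \<Rightarrow> bool) \<Rightarrow> 'v store \<Rightarrow> bool" where
  "wp W m Nop Q \<sigma> \<longleftrightarrow> Q \<sigma>"
| "wp W m (Assign x e) Q \<sigma> \<longleftrightarrow> asafe W e \<sigma> \<and> Q (assign x (aval e \<sigma>) \<sigma>)"
| "wp W m (Write a e) Q \<sigma> \<longleftrightarrow> asafe W a \<sigma> \<and> asafe W e \<sigma> \<and> 0 \<le> aval a \<sigma> \<and>
     Q (\<sigma>\<lparr>heap := (heap \<sigma>)(nat (aval a \<sigma>) := aval e \<sigma>)\<rparr>)"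
| "wp W m (Comp c d) Q \<sigma> \<longleftrightarrow> wp W m c (wp W m d Q) \<sigma>"
| "wp W m (Cond cmp a b c d) Q \<sigma> \<longleftrightarrow> asafe W a \<sigma> \<and> asafe W b \<sigma> \<and>
     (if compare cmp (aval a \<sigma>) (aval b \<sigma>) then wp W m c Q \<sigma> else wp W m d Q \<sigma>)"
| "wp W m (For x e c) Q \<sigma> \<longleftrightarrow> asafe W e \<sigma> \<and> nat (aval e \<sigma>) \<le> m \<and>
     (\<exists>I. I 0 \<sigma> \<and>
       (\<forall>i<nat (aval e \<sigma>). \<forall>\<sigma>. I i \<sigma> \<longrightarrow> wp W m c (I (Suc i)) (assign x (int i) \<sigma>)) \<and>
       (\<forall>\<sigma>'. I (nat (aval e \<sigma>)) \<sigma>' \<longrightarrow> Q \<sigma>'))"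

lemma wp_mono:
  assumes "wp W m c Q \<sigma>" "\<And>\<sigma>. Q \<sigma> \<Longrightarrow> Q' \<sigma>"
  shows "wp W m c Q' \<sigma>"
  using assms
proof (induction c arbitrary: Q Q' \<sigma>)
  case (Comp c d)
  have "wp W m d Q' \<sigma>'" if "wp W m d Q \<sigma>'" for \<sigma>'
    using Comp.IH(2) that Comp.prems(2) by blast
  then show ?case
    using Comp.IH(1)[of "wp W m d Q" \<sigma> "wp W m d Q'"] Comp.prems(1) by simp
next
  case (Cond cmp a b c d)
  show ?case
    using Cond.IH(1)[of Q \<sigma> Q'] Cond.IH(2)[of Q \<sigma> Q'] Cond.prems by (auto split: if_splits)
next
  case (For x e c)
  from For.prems show ?case unfolding wp.simps by blast
qed auto

lemma wp_Comp:
  assumes "wp W m c P \<sigma>" "\<And>\<sigma>. P \<sigma> \<Longrightarrow> wp W m d Q \<sigma>"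
  shows "wp W m (Comp c d) Q \<sigma>"
  using wp_mono[OF assms] by simp

lemma wp_For:
  assumes "asafe W e \<sigma>" "aval e \<sigma> = int k" "k \<le> m" "I 0 \<sigma>"
    and "\<And>i \<sigma>. i < k \<Longrightarrow> I i \<sigma> \<Longrightarrow> wp W m c (I (Suc i)) (assign x (int i) \<sigma>)"
  shows "wp W m (For x e c) (I k) \<sigma>"
  using assms by auto

section \<open>Compilation\<close>

text \<open>\<open>or x x = x\<close>, so \<open>Op BitOr r a a\<close> copies register \<open>a\<close> to \<open>r\<close>.\<close>

abbreviation copy_reg :: "reg \<Rightarrow> reg \<Rightarrow> com" where
  "copy_reg r a \<equiv> Op BitOr r a a"

fun acomp :: "('v \<Rightarrow> reg) \<Rightarrow> 'v aexp \<Rightarrow> reg \<Rightarrow> com" where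
  "acomp \<rho> (Num v) d = Const d v"
| "acomp \<rho> (Var x) d = copy_reg d (\<rho> x)"
| "acomp \<rho> (Bin f e e') d =
     Seq (acomp \<rho> e d) (Seq (acomp \<rho> e' (d + 1)) (Op f d d (d + 1)))"
| "acomp \<rho> (Mem e) d = Seq (acomp \<rho> e d) (Load d d)"

fun acost :: "'v aexp \<Rightarrow> nat" where
  "acost (Num v) = 1"
| "acost (Var x) = 1"
| "acost (Bin f e e') = acost e + (acost e' + 1)"
| "acost (Mem e) = acost e + 1"

fun test_of :: "comparison \<Rightarrow> reg \<Rightarrow> reg \<Rightarrow> test" where
  "test_of Lt = Less"
| "test_of Eq = Equal"

lemma eval_test_of: "eval_test (test_of cmp a b) s = compare cmp (regs s a) (regs s b)"
  by (cases cmp) auto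

fun compile :: "('v \<Rightarrow> reg) \<Rightarrow> reg \<Rightarrow> 'v stm \<Rightarrow> com" where
  "compile \<rho> Z Nop = Skip"
| "compile \<rho> Z (Assign x e) = Seq (acomp \<rho> e Z) (copy_reg (\<rho> x) Z)"
| "compile \<rho> Z (Write a e) =
     Seq (acomp \<rho> a Z) (Seq (acomp \<rho> e (Z + 1)) (Store Z (Z + 1)))"
| "compile \<rho> Z (Comp c d) = Seq (compile \<rho> Z c) (compile \<rho> Z d)"
| "compile \<rho> Z (Cond cmp a b c d) =
     Seq (acomp \<rho> a Z) (Seq (acomp \<rho> b (Z + 1))
       (If (test_of cmp Z (Z + 1)) (compile \<rho> Z c) (compile \<rho> Z d)))"
| "compile \<rho> Z (For x e c) =
     Seq (acomp \<rho> e Z) (Seq (Const (Z + 1) 0) (Seq (Const (Z + 2) 1)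
       (While (Less (Z + 1) Z)
         (Seq (copy_reg (\<rho> x) (Z + 1))
           (Seq (compile \<rho> (Z + 3) c) (Op Add (Z + 1) (Z + 1) (Z + 2)))))))"

fun cost :: "nat \<Rightarrow> 'v stm \<Rightarrow> nat" where
  "cost m Nop = 1"
| "cost m (Assign x e) = acost e + 1"
| "cost m (Write a e) = acost a + (acost e + 1)"
| "cost m (Comp c d) = cost m c + cost m d"
| "cost m (Cond cmp a b c d) = acost a + (acost b + Suc (cost m c + cost m d))"
| "cost m (For x e c) = acost e + (1 + (1 + (m * Suc (1 + (cost m c + 1)) + 1)))"

fun loop_depth :: "'v stm \<Rightarrow> nat" where
  "loop_depth (Comp c d) = max (loop_depth c) (loop_depth d)"
| "loop_depth (Cond cmp a b c d) = max (loop_depth c) (loop_depth d)"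
| "loop_depth (For x e c) = Suc (loop_depth c)"
| "loop_depth _ = 0"

lemma cost_le_power_loop_depth:
  assumes "1 \<le> m" "loop_depth c \<le> l"
  shows "cost m c \<le> m ^ l * cost 1 c"
proof -
  have scale: "a \<le> m ^ l * a" for a l :: nat
    using assms(1) by simp
  show ?thesis
    using assms(2)
  proof (induction c arbitrary: l)
    case (Comp c d)
    then show ?case by (simp add: distrib_left add_mono)
  next
    case (Cond cmp a b c d)
    let ?k = "acost a + acost b + 1"
    have "cost m c \<le> m ^ l * cost 1 c" "cost m d \<le> m ^ l * cost 1 d"
      using Cond by simp_all
    then have "?k + cost m c + cost m d \<le> m ^ l * (?k + cost 1 c + cost 1 d)"
      using scale[of ?k l] unfolding distrib_left by linarith
    then show ?case by (simp add: algebra_simps)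
  next
    case (For x e c)
    then obtain l' where l: "l = Suc l'" "loop_depth c \<le> l'" by (cases l) auto
    have "3 + cost m c \<le> m ^ l' * (3 + cost 1 c)"
      using For.IH[OF l(2)] scale[of 3 l'] unfolding distrib_left by linarith
    then have "m * (3 + cost m c) \<le> m ^ l * (3 + cost 1 c)"
      unfolding l power_Suc mult.assoc by (rule mult_le_mono2)
    then have "acost e + 3 + m * (3 + cost m c) \<le> m ^ l * (acost e + 3 + (3 + cost 1 c))"
      using scale[of "acost e + 3" l] unfolding distrib_left by linarith
    then show ?case by (simp add: algebra_simps)
  qed (unfold cost.simps, (rule scale)+)
qed

text \<open>The registers from \<open>Z\<close> on are scratch space.\<close>

definition represents ::
  "('v \<Rightarrow> reg) \<Rightarrow> reg \<Rightarrow> (reg \<Rightarrow> int) \<Rightarrow> 'v store \<Rightarrow> state \<Rightarrow> bool"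
where
  "represents \<rho> Z h \<sigma> s \<longleftrightarrow> range \<rho> \<subseteq> {..<Z} \<and> (\<forall>x. regs s (\<rho> x) = vars \<sigma> x) \<and>
     (\<forall>r<Z. r \<notin> range \<rho> \<longrightarrow> regs s r = h r) \<and> mem s = heap \<sigma>"

lemma represents_scratch_upd:
  assumes "represents \<rho> Z h \<sigma> s" "range \<rho> \<subseteq> {..<d}" "d \<le> Z"
  shows "represents \<rho> (d + 1) (h(d := v)) \<sigma> (s\<lparr>regs := (regs s)(d := v)\<rparr>)"
  using assms by (auto simp: represents_def)

lemma represents_scratch:
  assumes "represents \<rho> Z h \<sigma> s" "range \<rho> \<subseteq> {..<d}" "d \<le> r" "r < Z"
  shows "regs s r = h r"
proof -
  have "r \<notin> range \<rho>" using assms(2,3) by auto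
  then show ?thesis using assms(1,4) by (simp add: represents_def)
qed

lemma represents_restrict:
  assumes "represents \<rho> Z' h' \<sigma> s" "range \<rho> \<subseteq> {..<Z}" "Z \<le> Z'" "\<And>r. r < Z \<Longrightarrow> h' r = h r"
  shows "represents \<rho> Z h \<sigma> s"
  using assms by (auto simp: represents_def)

lemma represents_assign:
  assumes "inj \<rho>" "represents \<rho> Z h \<sigma> s"
  shows "represents \<rho> Z h (assign x v \<sigma>) (s\<lparr>regs := (regs s)(\<rho> x := v)\<rparr>)"
  using assms by (auto simp: represents_def inj_eq)

lemma represents_range: "represents \<rho> Z h \<sigma> s \<Longrightarrow> range \<rho> \<subseteq> {..<Z}"
  by (simp add: represents_def)

lemma runs_Op_scratch:
  assumes s: "represents \<rho> (d + 1 + 1) (h(d := v, d + 1 := v')) \<sigma> s" and \<rho>: "range \<rho> \<subseteq> {..<d}"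
    and "\<bar>eval_binop f v v'\<bar> < W"
  shows "runs W (Op f d d (d + 1)) s 1 (represents \<rho> (d + 1) (h(d := eval_binop f v v')) \<sigma>)"
proof (rule runs_Op)
  have v: "regs s d = v" "regs s (d + 1) = v'" using represents_scratch[OF s \<rho>] by simp_all
  show "\<bar>eval_binop f (regs s d) (regs s (d + 1))\<bar> < W" using assms(3) v by simp
  show "represents \<rho> (d + 1) (h(d := eval_binop f v v')) \<sigma>
      (s\<lparr>regs := (regs s)(d := eval_binop f (regs s d) (regs s (d + 1)))\<rparr>)"
    unfolding v by (rule represents_restrict[OF represents_scratch_upd[OF s \<rho>]]) (use \<rho> in auto)
qed

lemma runs_Load_scratch:
  assumes s: "represents \<rho> (d + 1) (h(d := v)) \<sigma> s" and \<rho>: "range \<rho> \<subseteq> {..<d}"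
    and "0 \<le> v" "\<bar>heap \<sigma> (nat v)\<bar> < W"
  shows "runs W (Load d d) s 1 (represents \<rho> (d + 1) (h(d := heap \<sigma> (nat v))) \<sigma>)"
proof (rule runs_Load)
  have v: "regs s d = v" "mem s = heap \<sigma>"
    using represents_scratch[OF s \<rho>] s by (simp_all add: represents_def)
  show "0 \<le> regs s d" "\<bar>mem s (nat (regs s d))\<bar> < W" using assms(3,4) v by simp_all
  show "represents \<rho> (d + 1) (h(d := heap \<sigma> (nat v))) \<sigma>
      (s\<lparr>regs := (regs s)(d := mem s (nat (regs s d)))\<rparr>)"
    unfolding v by (rule represents_restrict[OF represents_scratch_upd[OF s \<rho>]]) (use \<rho> in auto)
qed

lemma runs_acomp:
  assumes "represents \<rho> d h \<sigma> s" "asafe W e \<sigma>"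
  shows "runs W (acomp \<rho> e d) s (acost e) (represents \<rho> (d + 1) (h(d := aval e \<sigma>)) \<sigma>)"
  using assms
proof (induction e arbitrary: d h s)
  case (Num v)
  then have "\<bar>v\<bar> < W" by simp
  then show ?case unfolding acomp.simps acost.simps aval.simps
    by (rule runs_Const)
      (rule represents_scratch_upd[OF Num.prems(1) represents_range[OF Num.prems(1)] order_refl])
next
  case (Var x)
  then have "regs s (\<rho> x) = vars \<sigma> x" by (simp add: represents_def)
  moreover note represents_scratch_upd[OF Var.prems(1) represents_range[OF Var.prems(1)] order_refl]
  ultimately show ?case
    using Var.prems(2) unfolding acomp.simps acost.simps aval.simps asafe.simps
    by (intro runs_Op) (simp_all only: eval_binop.simps or.idem)
next
  case (Bin f e e')
  have \<rho>: "range \<rho> \<subseteq> {..<d}" using Bin.prems(1) by (rule represents_range)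
  have safe: "asafe W e \<sigma>" "asafe W e' \<sigma>" "\<bar>eval_binop f (aval e \<sigma>) (aval e' \<sigma>)\<bar> < W"
    using Bin.prems(2) by simp_all
  show ?case unfolding acomp.simps acost.simps aval.simps
    by (intro runs_Seq) (rule Bin.IH(1)[OF Bin.prems(1) safe(1)], erule Bin.IH(2)[OF _ safe(2)],
      erule runs_Op_scratch[OF _ \<rho> safe(3)])
next
  case (Mem e)
  have \<rho>: "range \<rho> \<subseteq> {..<d}" using Mem.prems(1) by (rule represents_range)
  have safe: "asafe W e \<sigma>" "0 \<le> aval e \<sigma>" "\<bar>heap \<sigma> (nat (aval e \<sigma>))\<bar> < W"
    using Mem.prems(2) by simp_all
  show ?case unfolding acomp.simps acost.simps aval.simps
    by (intro runs_Seq) (rule Mem.IH[OF Mem.prems(1) safe(1)],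
      erule runs_Load_scratch[OF _ \<rho> safe(2,3)])
qed

lemma asafe_abs_aval_less: "asafe W e \<sigma> \<Longrightarrow> \<bar>aval e \<sigma>\<bar> < W"
  by (cases e) auto

lemma runs_compile_Assign:
  assumes "inj \<rho>" "represents \<rho> Z h \<sigma> s" "asafe W e \<sigma>"
  shows "runs W (compile \<rho> Z (Assign x e)) s (cost m (Assign x e))
    (represents \<rho> Z h (assign x (aval e \<sigma>) \<sigma>))"
  unfolding compile.simps cost.simps
proof (rule runs_Seq[OF runs_acomp[OF assms(2,3)]])
  fix s assume s: "represents \<rho> (Z + 1) (h(Z := aval e \<sigma>)) \<sigma> s"
  have \<rho>: "range \<rho> \<subseteq> {..<Z}" using assms(2) by (rule represents_range)
  have "regs s Z = aval e \<sigma>" using represents_scratch[OF s \<rho>] by simp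
  moreover have "represents \<rho> Z h \<sigma> s" using s \<rho> by (rule represents_restrict) auto
  ultimately show "runs W (copy_reg (\<rho> x) Z) s 1 (represents \<rho> Z h (assign x (aval e \<sigma>) \<sigma>))"
    using asafe_abs_aval_less[OF assms(3)] represents_assign[OF assms(1)]
    by (intro runs_Op) simp_all
qed

lemma runs_acomp_pair:
  assumes "represents \<rho> Z h \<sigma> s" "asafe W a \<sigma>" "asafe W b \<sigma>"
    and cont: "\<And>s. represents \<rho> Z h \<sigma> s \<Longrightarrow> regs s Z = aval a \<sigma> \<Longrightarrow> regs s (Z + 1) = aval b \<sigma> \<Longrightarrow>
      runs W P s T Q"
  shows "runs W (Seq (acomp \<rho> a Z) (Seq (acomp \<rho> b (Z + 1)) P)) s (acost a + (acost b + T)) Q"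
proof (intro runs_Seq)
  show "runs W (acomp \<rho> a Z) s (acost a) (represents \<rho> (Z + 1) (h(Z := aval a \<sigma>)) \<sigma>)"
    using assms(1,2) by (rule runs_acomp)
next
  fix s assume "represents \<rho> (Z + 1) (h(Z := aval a \<sigma>)) \<sigma> s"
  then show "runs W (acomp \<rho> b (Z + 1)) s (acost b)
      (represents \<rho> (Z + 1 + 1) (h(Z := aval a \<sigma>, Z + 1 := aval b \<sigma>)) \<sigma>)"
    using assms(3) by (rule runs_acomp)
next
  fix s assume s: "represents \<rho> (Z + 1 + 1) (h(Z := aval a \<sigma>, Z + 1 := aval b \<sigma>)) \<sigma> s"
  have \<rho>: "range \<rho> \<subseteq> {..<Z}" using assms(1) by (rule represents_range)
  show "runs W P s T Q"
  proof (rule cont)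
    show "represents \<rho> Z h \<sigma> s" using s \<rho> by (rule represents_restrict) auto
    show "regs s Z = aval a \<sigma>" "regs s (Z + 1) = aval b \<sigma>"
      using represents_scratch[OF s \<rho>] by simp_all
  qed
qed

lemma runs_compile_Write:
  assumes "represents \<rho> Z h \<sigma> s" "asafe W a \<sigma>" "asafe W e \<sigma>" "0 \<le> aval a \<sigma>"
  shows "runs W (compile \<rho> Z (Write a e)) s (cost m (Write a e))
    (represents \<rho> Z h (\<sigma>\<lparr>heap := (heap \<sigma>)(nat (aval a \<sigma>) := aval e \<sigma>)\<rparr>))"
  unfolding compile.simps cost.simps
proof (rule runs_acomp_pair[OF assms(1-3)], rule runs_Store)
  fix s assume "represents \<rho> Z h \<sigma> s" "regs s Z = aval a \<sigma>" "regs s (Z + 1) = aval e \<sigma>"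
  then show "0 \<le> regs s Z"
    "represents \<rho> Z h (\<sigma>\<lparr>heap := (heap \<sigma>)(nat (aval a \<sigma>) := aval e \<sigma>)\<rparr>)
      (s\<lparr>mem := (mem s)(nat (regs s Z) := regs s (Z + 1))\<rparr>)"
    using assms(4) by (auto simp: represents_def)
qed

lemma runs_compile_Cond:
  assumes "represents \<rho> Z h \<sigma> s" "asafe W a \<sigma>" "asafe W b \<sigma>"
    and c: "\<And>s. compare cmp (aval a \<sigma>) (aval b \<sigma>) \<Longrightarrow> represents \<rho> Z h \<sigma> s \<Longrightarrow>
      runs W (compile \<rho> Z c) s (cost m c) Q"
    and d: "\<And>s. \<not> compare cmp (aval a \<sigma>) (aval b \<sigma>) \<Longrightarrow> represents \<rho> Z h \<sigma> s \<Longrightarrow>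
      runs W (compile \<rho> Z d) s (cost m d) Q"
  shows "runs W (compile \<rho> Z (Cond cmp a b c d)) s (cost m (Cond cmp a b c d)) Q"
  unfolding compile.simps cost.simps
proof (rule runs_acomp_pair[OF assms(1-3)], rule runs_If)
  fix s assume s: "represents \<rho> Z h \<sigma> s" "regs s Z = aval a \<sigma>" "regs s (Z + 1) = aval b \<sigma>"
  show "runs W (compile \<rho> Z c) s (cost m c + cost m d) Q" if "eval_test (test_of cmp Z (Z + 1)) s"
    using that s by (intro runs_mono[OF c]) (simp_all add: eval_test_of)
  show "runs W (compile \<rho> Z d) s (cost m c + cost m d) Q" if "\<not> eval_test (test_of cmp Z (Z + 1)) s"
    using that s by (intro runs_mono[OF d]) (simp_all add: eval_test_of)
qed

definition loop_regs :: "reg \<Rightarrow> int \<Rightarrow> nat \<Rightarrow> (reg \<Rightarrow> int) \<Rightarrow> reg \<Rightarrow> int" where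
  "loop_regs Z k i h = h(Z := k, Z + 1 := int i, Z + 2 := 1)"

lemma represents_loop_regs:
  assumes "represents \<rho> (Z + 3) (loop_regs Z k i h) \<sigma> s" "range \<rho> \<subseteq> {..<Z}"
  shows "regs s Z = k" "regs s (Z + 1) = int i" "regs s (Z + 2) = 1" "represents \<rho> Z h \<sigma> s"
proof -
  show "regs s Z = k" "regs s (Z + 1) = int i" "regs s (Z + 2) = 1"
    using represents_scratch[OF assms] by (simp_all add: loop_regs_def)
  show "represents \<rho> Z h \<sigma> s"
    using assms by (rule represents_restrict) (simp_all add: loop_regs_def)
qed

lemma runs_loop_setup:
  assumes "represents \<rho> (Z + 1) (h(Z := k)) \<sigma> s" "range \<rho> \<subseteq> {..<Z}" "1 < W"
    and cont: "\<And>s. represents \<rho> (Z + 3) (loop_regs Z k 0 h) \<sigma> s \<Longrightarrow> runs W P s T Q"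
  shows "runs W (Seq (Const (Z + 1) 0) (Seq (Const (Z + 2) 1) P)) s (1 + (1 + T)) Q"
proof (intro runs_Seq)
  have disjoint: "\<rho> x \<noteq> Z + 1" "\<rho> x \<noteq> Z + 2" for x using subsetD[OF assms(2) rangeI, of x] by auto
  show "runs W (Const (Z + 1) 0) s 1 (represents \<rho> (Z + 2) (h(Z := k, Z + 1 := 0)) \<sigma>)"
    using assms(1,3) disjoint by (intro runs_Const) (auto simp: represents_def)
  show "runs W (Const (Z + 2) 1) s 1 (represents \<rho> (Z + 3) (loop_regs Z k 0 h) \<sigma>)"
    if "represents \<rho> (Z + 2) (h(Z := k, Z + 1 := 0)) \<sigma> s" for s
    using that assms(3) disjoint by (intro runs_Const) (auto simp: represents_def loop_regs_def)
qed (rule cont)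

lemma runs_loop_body:
  assumes "inj \<rho>" "range \<rho> \<subseteq> {..<Z}" "represents \<rho> (Z + 3) (loop_regs Z k i h) \<sigma> s" "int i + 1 < W"
    and body: "\<And>h s. represents \<rho> (Z + 3) h (assign x (int i) \<sigma>) s \<Longrightarrow>
      runs W P s T (\<lambda>s'. \<exists>\<sigma>'. represents \<rho> (Z + 3) h \<sigma>' s' \<and> Q \<sigma>')"
  shows "runs W (Seq (copy_reg (\<rho> x) (Z + 1)) (Seq P (Op Add (Z + 1) (Z + 1) (Z + 2)))) s
    (1 + (T + 1)) (\<lambda>s'. \<exists>\<sigma>'. represents \<rho> (Z + 3) (loop_regs Z k (Suc i) h) \<sigma>' s' \<and> Q \<sigma>')"
proof (intro runs_Seq)
  show "runs W (copy_reg (\<rho> x) (Z + 1)) s 1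
      (represents \<rho> (Z + 3) (loop_regs Z k i h) (assign x (int i) \<sigma>))"
    using represents_loop_regs(2)[OF assms(3,2)] represents_assign[OF assms(1,3)] assms(4)
    by (intro runs_Op) simp_all
next
  fix s assume "represents \<rho> (Z + 3) (loop_regs Z k i h) (assign x (int i) \<sigma>) s"
  then show "runs W P s T (\<lambda>s'. \<exists>\<sigma>'. represents \<rho> (Z + 3) (loop_regs Z k i h) \<sigma>' s' \<and> Q \<sigma>')"
    by (rule body)
next
  have disjoint: "\<rho> x \<noteq> Z + 1" for x using subsetD[OF assms(2) rangeI, of x] by auto
  fix s assume "\<exists>\<sigma>'. represents \<rho> (Z + 3) (loop_regs Z k i h) \<sigma>' s \<and> Q \<sigma>'"
  then obtain \<sigma>' where s: "represents \<rho> (Z + 3) (loop_regs Z k i h) \<sigma>' s" "Q \<sigma>'" by blast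
  have "represents \<rho> (Z + 3) (loop_regs Z k (Suc i) h) \<sigma>' (s\<lparr>regs := (regs s)(Z + 1 := int i + 1)\<rparr>)"
    using s(1) disjoint by (auto simp: represents_def loop_regs_def)
  then show "runs W (Op Add (Z + 1) (Z + 1) (Z + 2)) s 1
      (\<lambda>s'. \<exists>\<sigma>'. represents \<rho> (Z + 3) (loop_regs Z k (Suc i) h) \<sigma>' s' \<and> Q \<sigma>')"
    using represents_loop_regs[OF s(1) assms(2)] s(2) assms(4) by (intro runs_Op) auto
qed

lemma runs_compile_For:
  assumes "inj \<rho>" "represents \<rho> Z h \<sigma> s" "1 < W" "asafe W e \<sigma>"
    and k: "k = nat (aval e \<sigma>)" "k \<le> m"
    and I: "I 0 \<sigma>"
    and body: "\<And>i \<sigma> h s. i < k \<Longrightarrow> I i \<sigma> \<Longrightarrow> represents \<rho> (Z + 3) h (assign x (int i) \<sigma>) s \<Longrightarrow>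
      runs W (compile \<rho> (Z + 3) c) s (cost m c)
        (\<lambda>s'. \<exists>\<sigma>'. represents \<rho> (Z + 3) h \<sigma>' s' \<and> I (Suc i) \<sigma>')"
  shows "runs W (compile \<rho> Z (For x e c)) s (cost m (For x e c))
    (\<lambda>s'. \<exists>\<sigma>'. represents \<rho> Z h \<sigma>' s' \<and> I k \<sigma>')"
  unfolding compile.simps cost.simps
proof (rule runs_Seq[OF runs_acomp[OF assms(2,4)]])
  have \<rho>: "range \<rho> \<subseteq> {..<Z}" using assms(2) by (rule represents_range)
  define J where "J i s \<longleftrightarrow>
    (\<exists>\<sigma>'. represents \<rho> (Z + 3) (loop_regs Z (aval e \<sigma>) i h) \<sigma>' s \<and> I i \<sigma>')" for i s
  fix s assume "represents \<rho> (Z + 1) (h(Z := aval e \<sigma>)) \<sigma> s"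
  then show "runs W (Seq (Const (Z + 1) 0) (Seq (Const (Z + 2) 1) (While (Less (Z + 1) Z)
        (Seq (copy_reg (\<rho> x) (Z + 1))
          (Seq (compile \<rho> (Z + 3) c) (Op Add (Z + 1) (Z + 1) (Z + 2)))))))
      s (1 + (1 + (m * Suc (1 + (cost m c + 1)) + 1))) (\<lambda>s'. \<exists>\<sigma>'. represents \<rho> Z h \<sigma>' s' \<and> I k \<sigma>')"
    (is "runs W (Seq _ (Seq _ (While ?b ?body))) s _ ?Q")
  proof (rule runs_loop_setup[OF _ \<rho> assms(3)])
    fix s assume "represents \<rho> (Z + 3) (loop_regs Z (aval e \<sigma>) 0 h) \<sigma> s"
    with I have "J 0 s" unfolding J_def by blast
    then have "runs W (While ?b ?body) s (k * Suc (1 + (cost m c + 1)) + 1) (J k)"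
    proof (rule runs_While)
      fix i s assume i: "i < k" and "J i s"
      then obtain \<sigma>' where s: "represents \<rho> (Z + 3) (loop_regs Z (aval e \<sigma>) i h) \<sigma>' s" "I i \<sigma>'"
        by (auto simp: J_def)
      have "int i + 1 < W" using i k(1) asafe_abs_aval_less[OF assms(4)] by linarith
      then have "runs W ?body s (1 + (cost m c + 1)) (J (Suc i))"
        unfolding J_def by (rule runs_loop_body[OF assms(1) \<rho> s(1)]) (rule body[OF i s(2)])
      then show "eval_test ?b s \<and> runs W ?body s (1 + (cost m c + 1)) (J (Suc i))"
        using represents_loop_regs[OF s(1) \<rho>] i k(1) by simp
    next
      fix s assume "J k s"
      then obtain \<sigma>' where "represents \<rho> (Z + 3) (loop_regs Z (aval e \<sigma>) k h) \<sigma>' s"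
        unfolding J_def by blast
      then show "\<not> eval_test ?b s" using represents_loop_regs(1,2)[OF _ \<rho>] k(1) by simp
    qed
    then show "runs W (While ?b ?body) s (m * Suc (1 + (cost m c + 1)) + 1) ?Q"
    proof (rule runs_mono)
      show "k * Suc (1 + (cost m c + 1)) + 1 \<le> m * Suc (1 + (cost m c + 1)) + 1"
        by (intro add_le_mono1 mult_le_mono1 k(2))
      show "?Q s'" if "J k s'" for s'
        using that unfolding J_def by (blast dest: represents_loop_regs(4)[OF _ \<rho>])
    qed
  qed
qed

lemma runs_compile:
  assumes "inj \<rho>" "represents \<rho> Z h \<sigma> s" "1 < W" "wp W m c Q \<sigma>"
  shows "runs W (compile \<rho> Z c) s (cost m c) (\<lambda>s'. \<exists>\<sigma>'. represents \<rho> Z h \<sigma>' s' \<and> Q \<sigma>')"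
  using assms(2,4)
proof (induction c arbitrary: Z h \<sigma> s Q)
  case Nop
  then show ?case unfolding compile.simps cost.simps by (intro runs_Skip) auto
next
  case (Assign x e)
  then have "asafe W e \<sigma>" "Q (assign x (aval e \<sigma>) \<sigma>)" by simp_all
  with runs_compile_Assign[OF assms(1) Assign.prems(1)] show ?case
    by (blast intro: runs_mono)
next
  case (Write a e)
  then have "asafe W a \<sigma>" "asafe W e \<sigma>" "0 \<le> aval a \<sigma>"
    "Q (\<sigma>\<lparr>heap := (heap \<sigma>)(nat (aval a \<sigma>) := aval e \<sigma>)\<rparr>)" by simp_all
  with runs_compile_Write[OF Write.prems(1)] show ?case
    by (blast intro: runs_mono)
next
  case (Comp c d)
  show ?case unfolding compile.simps cost.simps
    by (rule runs_Seq[OF Comp.IH(1)[where Q = "wp W m d Q"]])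
      (use Comp.IH(2) Comp.prems in auto)
next
  case (Cond cmp a b c d)
  from Cond.prems(1) show ?case
    by (rule runs_compile_Cond) (use Cond.IH Cond.prems(2) in auto)
next
  case (For x e c)
  let ?k = "nat (aval e \<sigma>)"
  obtain I where I: "I 0 \<sigma>" "\<And>\<sigma>'. I ?k \<sigma>' \<Longrightarrow> Q \<sigma>'"
    "\<And>i \<sigma>. i < ?k \<Longrightarrow> I i \<sigma> \<Longrightarrow> wp W m c (I (Suc i)) (assign x (int i) \<sigma>)"
    using For.prems(2) unfolding wp.simps by blast
  have "runs W (compile \<rho> Z (For x e c)) s (cost m (For x e c))
      (\<lambda>s'. \<exists>\<sigma>'. represents \<rho> Z h \<sigma>' s' \<and> I ?k \<sigma>')"
  proof (rule runs_compile_For[where I = I, OF assms(1) For.prems(1) assms(3) _ refl _ I(1)])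
    show "asafe W e \<sigma>" "?k \<le> m" using For.prems(2) by simp_all
    show "runs W (compile \<rho> (Z + 3) c) s (cost m c)
        (\<lambda>s'. \<exists>\<sigma>'. represents \<rho> (Z + 3) h \<sigma>' s' \<and> I (Suc i) \<sigma>')"
      if "i < ?k" "I i \<sigma>'" "represents \<rho> (Z + 3) h (assign x (int i) \<sigma>') s" for i \<sigma>' h s
      using that(3) I(3)[OF that(1,2)] by (rule For.IH)
  qed
  then show ?case by (rule runs_mono) (use I(2) in auto)
qed

section \<open>Reductions between problems\<close>

text \<open>
  Between \<open>enc\<close> and \<open>dec\<close>, the variables keep their values, whereas the memory is replaced by an
  arbitrary one that satisfies \<open>Q'\<close>.
\<close>

definition reduces_instance ::
  "int \<Rightarrow> nat \<Rightarrow> 'v stm \<Rightarrow> 'v stm \<Rightarrow> int list \<Rightarrow> ((nat \<Rightarrow> int) \<Rightarrow> bool) \<Rightarrow>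
    int list \<Rightarrow> ((nat \<Rightarrow> int) \<Rightarrow> bool) \<Rightarrow> bool"
where
  "reduces_instance W m enc dec xs Q ys Q' \<longleftrightarrow>
    (\<forall>\<sigma>. heap \<sigma> = mem (init_state xs) \<longrightarrow>
      wp W m enc (\<lambda>\<sigma>. heap \<sigma> = mem (init_state ys) \<and>
        (\<forall>M. Q' M \<longrightarrow> wp W m dec (\<lambda>\<sigma>. Q (heap \<sigma>)) (\<sigma>\<lparr>heap := M\<rparr>))) \<sigma>)"

lemma obtain_registers:
  obtains \<rho> :: "'v::finite \<Rightarrow> reg" and Z where "inj \<rho>" "range \<rho> \<subseteq> {R..<Z}"
proof -
  obtain f :: "'v \<Rightarrow> nat" and n where f: "f ` UNIV = {i. i < n}" "inj f"
    using finite_imp_inj_to_nat_seg[OF finite_UNIV] by metis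
  show thesis
  proof
    show "inj (\<lambda>x. R + f x)" using f(2) by (simp add: inj_def)
    show "range (\<lambda>x. R + f x) \<subseteq> {R..<R + n}" using f(1) by auto
  qed
qed

lemma runs_with_high_registers:
  assumes \<rho>: "range \<rho> \<subseteq> {R..<Z}" and P: "com_regs P \<subseteq> {..<R}" "exec W P (init_state ys) t s'"
    and s: "represents \<rho> Z (\<lambda>_. 0) \<sigma> s" "heap \<sigma> = mem (init_state ys)"
  shows "runs W P s t (\<lambda>s. \<exists>h. represents \<rho> Z h (\<sigma>\<lparr>heap := mem s'\<rparr>) s)"
proof -
  let ?override = "override_high_regs R (regs s)"
  have low: "r \<notin> range \<rho>" if "r < R" for r using \<rho> that by auto
  have "s = ?override (init_state ys)"
  proof (rule state.equality)
    have "regs s r = regs (?override (init_state ys)) r" for r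
      using s(1) low[of r] \<rho> by (cases "r < Z") (auto simp: represents_def init_state_def)
    then show "regs s = regs (?override (init_state ys))" ..
  qed (use s in \<open>simp_all add: represents_def\<close>)
  then have "exec W P s t (?override s')"
    using exec_override_high_regs[OF P(2,1), of "regs s"] by simp
  moreover have "represents \<rho> Z (regs (?override s')) (\<sigma>\<lparr>heap := mem s'\<rparr>) (?override s')"
    using s(1) low by (force simp: represents_def)
  ultimately show ?thesis unfolding runs_def by blast
qed

lemma runs_reduction:
  assumes "inj \<rho>" "range \<rho> \<subseteq> {R..<Z}" "com_regs P \<subseteq> {..<R}" "1 < W"
    and reduction: "reduces_instance W m enc dec xs Q ys Q'"
    and P: "exec W P (init_state ys) t s'" "Q' (mem s')"
  shows "runs W (Seq (compile \<rho> Z enc) (Seq P (compile \<rho> Z dec))) (init_state xs)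
    (cost m enc + (t + cost m dec)) (\<lambda>s. Q (mem s))"
proof (intro runs_Seq)
  let ?wp_dec = "wp W m dec (\<lambda>\<sigma>. Q (heap \<sigma>))"
  define ready where
    "ready \<sigma> \<longleftrightarrow> heap \<sigma> = mem (init_state ys) \<and> (\<forall>M. Q' M \<longrightarrow> ?wp_dec (\<sigma>\<lparr>heap := M\<rparr>))" for \<sigma>
  let ?\<sigma> = "\<lparr>vars = (\<lambda>_. 0), heap = mem (init_state xs)\<rparr>"
  have "represents \<rho> Z (\<lambda>_. 0) ?\<sigma> (init_state xs)"
    using assms(2) by (auto simp: represents_def init_state_def)
  moreover have "wp W m enc ready ?\<sigma>"
    using reduction unfolding reduces_instance_def ready_def by simp
  ultimately show "runs W (compile \<rho> Z enc) (init_state xs) (cost m enc)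
      (\<lambda>s. \<exists>\<sigma>. represents \<rho> Z (\<lambda>_. 0) \<sigma> s \<and> ready \<sigma>)"
    by (rule runs_compile[OF assms(1) _ assms(4)])
  show "runs W P s t (\<lambda>s. \<exists>h \<sigma>. represents \<rho> Z h \<sigma> s \<and> ?wp_dec \<sigma>)"
    if s: "\<exists>\<sigma>. represents \<rho> Z (\<lambda>_. 0) \<sigma> s \<and> ready \<sigma>" for s
  proof -
    obtain \<sigma> where \<sigma>: "represents \<rho> Z (\<lambda>_. 0) \<sigma> s" "heap \<sigma> = mem (init_state ys)"
        "?wp_dec (\<sigma>\<lparr>heap := mem s'\<rparr>)"
      using s P(2) unfolding ready_def by blast
    from runs_with_high_registers[OF assms(2,3) P(1) \<sigma>(1,2)] show ?thesis
      by (rule runs_mono) (use \<sigma>(3) in auto)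
  qed
  show "runs W (compile \<rho> Z dec) s (cost m dec) (\<lambda>s. Q (mem s))"
    if s: "\<exists>h \<sigma>. represents \<rho> Z h \<sigma> s \<and> ?wp_dec \<sigma>" for s
  proof -
    obtain h \<sigma> where "represents \<rho> Z h \<sigma> s" "?wp_dec \<sigma>" using s by blast
    from runs_compile[OF assms(1) this(1) assms(4) this(2)] show ?thesis
      by (rule runs_mono) (auto simp: represents_def)
  qed
qed

lemma reduction_time_le:
  fixes enc dec :: "'v stm" and C C1 C2 T T' :: real
  assumes "1 \<le> m" "loop_depth enc \<le> l" "loop_depth dec \<le> l"
    and overhead: "real (m ^ l) \<le> C1 * T" and target: "0 \<le> T'" "T' \<le> C2 * T"
    and "real t \<le> C * T'" "t' \<le> cost m enc + (t + cost m dec)"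
  shows "real t' \<le> (C1 * real (cost 1 enc + cost 1 dec) + \<bar>C\<bar> * C2) * T"
proof -
  have "cost m enc + cost m dec \<le> m ^ l * (cost 1 enc + cost 1 dec)"
    using cost_le_power_loop_depth[of m "Comp enc dec" l] assms(1-3) by simp
  then have "real (cost m enc + cost m dec) \<le> real (m ^ l) * real (cost 1 enc + cost 1 dec)"
    by (metis of_nat_mono of_nat_mult)
  also have "\<dots> \<le> C1 * T * real (cost 1 enc + cost 1 dec)"
    using overhead by (intro mult_right_mono) auto
  finally have "real (cost m enc + cost m dec) \<le> C1 * T * real (cost 1 enc + cost 1 dec)" .
  moreover have "real t \<le> \<bar>C\<bar> * (C2 * T)"
  proof -
    have "real t \<le> \<bar>C\<bar> * T'"
      using assms(7) target(1) by (meson abs_ge_self mult_right_mono order_trans)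
    also have "\<dots> \<le> \<bar>C\<bar> * (C2 * T)" using target(2) by (intro mult_left_mono) auto
    finally show ?thesis .
  qed
  moreover have "real t' \<le> real (cost m enc + cost m dec) + real t"
    using assms(8) by (simp flip: of_nat_add)
  ultimately show ?thesis by (simp add: algebra_simps)
qed

theorem solvable_in_time_reduction:
  fixes enc dec :: "'v::finite stm"
  assumes solvable: "solvable_in_time inst' inp' correct' T'"
    and size: "\<And>n. 1 \<le> n \<Longrightarrow> 1 \<le> N n \<and> int (N n) + 2 \<le> (int n + 2) ^ a"
    and reduction: "\<And>n x W. 1 \<le> n \<Longrightarrow> x \<in> inst n \<Longrightarrow> (int n + 2) ^ b \<le> W \<Longrightarrow>
      \<exists>y\<in>inst' (N n). reduces_instance W (m n) enc dec (inp x) (correct x) (inp' y) (correct' y)"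
    and depth: "loop_depth enc \<le> l" "loop_depth dec \<le> l"
    and overhead: "\<And>n. 1 \<le> n \<Longrightarrow> 1 \<le> m n \<and> real (m n ^ l) \<le> C1 * T n"
    and target: "\<And>n. 1 \<le> n \<Longrightarrow> 0 \<le> T' (N n) \<and> T' (N n) \<le> C2 * T n"
  shows "solvable_in_time inst inp correct T"
proof -
  obtain P c and C :: real where P: "\<And>n y. 1 \<le> n \<Longrightarrow> y \<in> inst' n \<Longrightarrow> \<exists>t s.
      exec ((int n + 2) ^ c) P (init_state (inp' y)) t s \<and> real t \<le> C * T' n \<and> correct' y (mem s)"
    using solvable unfolding solvable_in_time_def by meson
  obtain R where R: "com_regs P \<subseteq> {..<R}"
    using finite_com_regs finite_nat_bounded by blast
  obtain \<rho> :: "'v \<Rightarrow> reg" and Z where \<rho>: "inj \<rho>" "range \<rho> \<subseteq> {R..<Z}"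
    by (rule obtain_registers)
  let ?P = "Seq (compile \<rho> Z enc) (Seq P (compile \<rho> Z dec))"
  let ?e = "Suc (b + a * c)"
  let ?C = "C1 * real (cost 1 enc + cost 1 dec) + \<bar>C\<bar> * C2"
  have "\<exists>t s. exec ((int n + 2) ^ ?e) ?P (init_state (inp x)) t s \<and>
      real t \<le> ?C * T n \<and> correct x (mem s)" if n: "1 \<le> n" and x: "x \<in> inst n" for n x
  proof -
    let ?w = "int n + 2"
    have "1 < ?w ^ ?e" by (intro one_less_power) auto
    have "?w ^ b \<le> ?w ^ ?e" by (intro power_increasing) auto
    from reduction[OF n x this] obtain y where y: "y \<in> inst' (N n)"
      "reduces_instance (?w ^ ?e) (m n) enc dec (inp x) (correct x) (inp' y) (correct' y)"
      by blast
    obtain t s where t: "exec ((int (N n) + 2) ^ c) P (init_state (inp' y)) t s"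
        "real t \<le> C * T' (N n)" "correct' y (mem s)"
      using P[OF _ y(1)] size[OF n] by blast
    have "exec (?w ^ ?e) P (init_state (inp' y)) t s"
      using size[OF n] by (intro exec_word_bound_power[OF t(1)]) auto
    from runs_reduction[OF \<rho> R \<open>1 < ?w ^ ?e\<close> y(2) this t(3)]
    obtain t' s' where run: "exec (?w ^ ?e) ?P (init_state (inp x)) t' s'"
        "t' \<le> cost (m n) enc + (t + cost (m n) dec)" "correct x (mem s')"
      unfolding runs_def by auto
    have "real t' \<le> ?C * T n"
      by (rule reduction_time_le[OF _ depth _ _ _ t(2) run(2)])
        (use overhead[OF n] target[OF n] in auto)
    with run show ?thesis by blast
  qed
  then show ?thesis unfolding solvable_in_time_def
    by (intro exI[of _ ?P] exI[of _ ?e] exI[of _ ?C]) blast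
qed

section \<open>The graph of a min-plus product\<close>

lemma (in wf_digraph) potential_le_awalk_cost:
  fixes \<phi> :: "'a \<Rightarrow> real"
  assumes "\<And>e. e \<in> arcs G \<Longrightarrow> \<phi> (head G e) \<le> \<phi> (tail G e) + f e" "awalk u p v"
  shows "\<phi> v - \<phi> u \<le> awalk_cost f p"
  using assms(2)
proof (induction p arbitrary: u)
  case (Cons e p)
  then have "e \<in> arcs G" "tail G e = u" "awalk (head G e) p v" by (auto simp: awalk_Cons_iff)
  with Cons.IH assms(1)[of e] show ?case by fastforce
qed (auto simp: awalk_Nil_iff)

lemma (in wf_digraph) potential_le_\<mu>:
  fixes \<phi> :: "'a \<Rightarrow> real"
  assumes "\<And>e. e \<in> arcs G \<Longrightarrow> \<phi> (head G e) \<le> \<phi> (tail G e) + f e"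
  shows "ereal (\<phi> v - \<phi> u) \<le> \<mu> f u v"
  unfolding \<mu>_def using potential_le_awalk_cost[OF assms] by (intro INF_greatest) auto

text \<open>
  Vertices \<open>i < n\<close> stand for the rows of the first matrix, \<open>n + j\<close> for the columns of the second, and
  \<open>chain k p\<close> with \<open>p < S\<close> for the positions on the chain of the inner index \<open>k\<close>. The numbers
  \<open>\<alpha> i k\<close> and \<open>\<beta> k j\<close> are the matrix entries, shifted to lie between \<open>0\<close> and \<open>B\<close>. The vertices below
  \<open>N\<close> that are not needed are isolated.
\<close>

locale min_plus_gadget =
  fixes n K D B N :: nat and \<alpha> \<beta> :: "nat \<Rightarrow> nat \<Rightarrow> nat"
  assumes K_pos: "0 < K" and D_pos: "0 < D"
    and order: "2 * n + K * Suc (2 * (B div D)) \<le> N"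
    and \<alpha>_le: "\<And>i k. i < n \<Longrightarrow> k < K \<Longrightarrow> \<alpha> i k \<le> B"
    and \<beta>_le: "\<And>k j. k < K \<Longrightarrow> j < n \<Longrightarrow> \<beta> k j \<le> B"
begin

definition L :: nat where "L = B div D"
abbreviation S :: nat where "S \<equiv> Suc (2 * L)"
definition M :: nat where "M = D * S"

definition chain :: "nat \<Rightarrow> nat \<Rightarrow> nat" where
  "chain k p = 2 * n + k * S + p"

definition chain_index :: "nat \<Rightarrow> nat" where
  "chain_index y = (y - 2 * n) div S"

definition chain_position :: "nat \<Rightarrow> nat" where
  "chain_position y = (y - 2 * n) mod S"

lemma chain_index_chain: "p < S \<Longrightarrow> chain_index (chain k p) = k"
  and chain_position_chain: "p < S \<Longrightarrow> chain_position (chain k p) = p"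
proof -
  have "chain k p - 2 * n = p + k * S" by (simp add: chain_def)
  then show "p < S \<Longrightarrow> chain_index (chain k p) = k" "p < S \<Longrightarrow> chain_position (chain k p) = p"
    unfolding chain_index_def chain_position_def
    by (simp_all only: div_mult_self1 mod_mult_self1) simp_all
qed

lemma chain_position_less: "chain_position y < S"
  by (simp add: chain_position_def)

lemma chain_index_position: "2 * n \<le> y \<Longrightarrow> chain (chain_index y) (chain_position y) = y"
  unfolding chain_def chain_index_def chain_position_def
  by (simp only: add.assoc div_mult_mod_eq le_add_diff_inverse)

lemma chain_ge: "2 * n \<le> chain k p"
  by (simp add: chain_def)

lemma chain_less:
  assumes "k < K" "p < S"
  shows "chain k p < N"
proof -
  have "k * S + p < Suc k * S" using assms(2) by simp
  also have "\<dots> \<le> K * S" using assms(1) by (intro mult_le_mono1) simp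
  finally show ?thesis using order by (simp add: chain_def L_def)
qed

lemma \<alpha>_div_le: "i < n \<Longrightarrow> k < K \<Longrightarrow> \<alpha> i k div D \<le> L"
  using \<alpha>_le div_le_mono by (simp add: L_def)

lemma \<beta>_div_le: "k < K \<Longrightarrow> j < n \<Longrightarrow> \<beta> k j div D \<le> L"
  using \<beta>_le div_le_mono by (simp add: L_def)

definition link :: "nat \<Rightarrow> nat \<Rightarrow> nat option" where
  "link x y = (let k = chain_index y; p = chain_position y in
     if y < 2 * n \<or> K \<le> k then None
     else if x < n then (if p = L - \<alpha> x k div D then Some (M + \<alpha> x k mod D) else None)
     else if x < 2 * n then
       (if p = L + \<beta> k (x - n) div D then Some (M + \<beta> k (x - n) mod D) else None)
     else if x + 1 = y \<and> 0 < p then Some D else None)"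

definition edge :: "nat \<Rightarrow> nat \<Rightarrow> nat option" where
  "edge u v = link (min u v) (max u v)"

definition graph :: "nat pair_pre_digraph" where
  "graph = \<lparr>pverts = {..<N}, parcs = {(u, v). u < N \<and> v < N \<and> edge u v \<noteq> None}\<rparr>"

definition weight :: "nat \<times> nat \<Rightarrow> int" where
  "weight = (\<lambda>(u, v). int (the (edge u v)))"

abbreviation walk_cost :: "(nat \<times> nat) awalk \<Rightarrow> real" where
  "walk_cost \<equiv> wf_digraph.awalk_cost (\<lambda>e. real_of_int (weight e))"

lemma edge_commute: "edge u v = edge v u"
  by (simp add: edge_def min.commute max.commute)

lemma edge_row:
  assumes "i < n" "k < K"
  shows "edge i (chain k (L - \<alpha> i k div D)) = Some (M + \<alpha> i k mod D)"
proof -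
  have "L - \<alpha> i k div D < S" by simp
  then show ?thesis
    using assms chain_ge[of k "L - \<alpha> i k div D"]
    by (simp add: edge_def link_def chain_index_chain chain_position_chain)
qed

lemma edge_column:
  assumes "j < n" "k < K"
  shows "edge (n + j) (chain k (L + \<beta> k j div D)) = Some (M + \<beta> k j mod D)"
proof -
  have "L + \<beta> k j div D < S" using \<beta>_div_le[OF assms(2,1)] by simp
  then show ?thesis
    using assms chain_ge[of k "L + \<beta> k j div D"]
    by (simp add: edge_def link_def chain_index_chain chain_position_chain)
qed

lemma edge_chain:
  assumes "k < K" "Suc p < S"
  shows "edge (chain k p) (chain k (Suc p)) = Some D"
proof -
  have Suc: "chain k (Suc p) = Suc (chain k p)" by (simp add: chain_def)
  then have "chain_index (Suc (chain k p)) = k" "chain_position (Suc (chain k p)) = Suc p"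
    using chain_index_chain[OF assms(2), of k] chain_position_chain[OF assms(2), of k] by simp_all
  then show ?thesis
    using assms(1) chain_ge[of k p] by (simp add: edge_def link_def Suc)
qed

lemma link_cases:
  assumes "link x y = Some w"
  obtains (row) k where "x < n" "k < K" "y = chain k (L - \<alpha> x k div D)" "w = M + \<alpha> x k mod D"
  | (column) j k where "x = n + j" "j < n" "k < K" "y = chain k (L + \<beta> k j div D)"
      "w = M + \<beta> k j mod D"
  | (chain) k p where "k < K" "Suc p < S" "x = chain k p" "y = chain k (Suc p)" "w = D"
proof -
  define k p where "k = chain_index y" and "p = chain_position y"
  note link = assms[unfolded link_def Let_def, folded k_def p_def]
  have k: "k < K" and y: "2 * n \<le> y" using link by (auto split: if_splits)
  have chain_y: "y = chain k p"
    unfolding k_def p_def by (rule chain_index_position[OF y, symmetric])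
  have p: "p < S" unfolding p_def by (rule chain_position_less)
  consider "x < n" | "n \<le> x" "x < 2 * n" | "2 * n \<le> x" by linarith
  then show thesis
  proof cases
    assume "x < n"
    then show thesis using link row[of k] k chain_y by (auto split: if_splits)
  next
    assume "n \<le> x" "x < 2 * n"
    then show thesis using link column[of "x - n" k] k chain_y by (auto split: if_splits)
  next
    assume "2 * n \<le> x"
    then have "x + 1 = y" "0 < p" "w = D" using link by (auto split: if_splits)
    then show thesis using chain[of k "p - 1"] k chain_y p by (auto simp: chain_def)
  qed
qed

lemma edge_weight_range: "edge u v = Some w \<Longrightarrow> w \<in> insert D {M..<M + D}"
  unfolding edge_def using D_pos by (elim link_cases) auto

lemma pair_graph: "pair_graph graph"
proof
  show "finite (parcs graph)"
    by (rule finite_subset[of _ "{..<N} \<times> {..<N}"]) (auto simp: graph_def)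
  show "symmetric (with_proj graph)"
    by (auto simp: symmetric_def graph_def edge_commute intro!: symI)
next
  fix e assume "e \<in> parcs graph"
  then show "fst e \<noteq> snd e"
    by (auto simp: graph_def edge_def elim!: link_cases) (auto simp: chain_def)
qed (auto simp: graph_def)

sublocale pair_graph graph by (rule pair_graph)

lemma graph_undirected: "(graph, weight) \<in> undirected_graphs N"
proof -
  have "0 \<le> weight e" for e by (cases e) (simp add: weight_def)
  then have "0 \<le> walk_cost p" for p
    unfolding awalk_cost_def by (intro sum_list_nonneg) auto
  then have "no_negative_cycle graph weight" by (simp add: no_negative_cycle_def)
  moreover have "pair_digraph graph" ..
  ultimately show ?thesis using pair_graph
    by (auto simp: undirected_graphs_def directed_graphs_def graph_def weight_def edge_commute)
qed

lemma card_weights_le: "card (weight ` parcs graph) \<le> D + 1"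
proof -
  have "weight ` parcs graph \<subseteq> int ` insert D {M..<M + D}"
    using edge_weight_range by (fastforce simp: graph_def weight_def)
  then have "card (weight ` parcs graph) \<le> card (int ` insert D {M..<M + D})"
    by (intro card_mono) auto
  also have "\<dots> \<le> card (insert D {M..<M + D})" by (rule card_image_le) simp
  also have "\<dots> \<le> D + 1" by (simp add: card_insert_if)
  finally show ?thesis .
qed

lemma edge_weight_le:
  assumes "edge u v = Some w"
  shows "w \<le> 2 * (B + D)"
proof -
  have "D * L \<le> B" unfolding L_def by simp
  moreover have "w \<le> M + D" using edge_weight_range[OF assms] D_pos by (auto simp: M_def)
  ultimately show ?thesis by (simp add: M_def)
qed

definition row_chain_dist :: "nat \<Rightarrow> nat \<Rightarrow> nat \<Rightarrow> int" where
  "row_chain_dist i k p =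
     int M + int (\<alpha> i k mod D) + int D * \<bar>int p - (int L - int (\<alpha> i k div D))\<bar>"

definition min_sum :: "nat \<Rightarrow> nat \<Rightarrow> nat" where
  "min_sum i j = Min ((\<lambda>k. \<alpha> i k + \<beta> k j) ` {..<K})"

text \<open>
  A lower bound for the distance from \<open>i\<close>. It is exact on the columns, because a path
  that visits a row or column on its way pays at least two further edges of weight \<open>M\<close>.
\<close>

definition potential :: "nat \<Rightarrow> nat \<Rightarrow> int" where
  "potential i v = (if v = i then 0 else if v < n then 2 * int M
     else if v < 2 * n then 2 * int M + int (min_sum i (v - n))
     else row_chain_dist i (chain_index v) (chain_position v))"

lemma potential_chain:
  assumes "i < n" "p < S"
  shows "potential i (chain k p) = row_chain_dist i k p"
  using assms chain_ge[of k p] by (simp add: potential_def chain_index_chain chain_position_chain)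

lemma row_chain_dist_ge: "int M \<le> row_chain_dist i k p"
  by (simp add: row_chain_dist_def)

lemma row_chain_dist_le:
  assumes "i < n" "k < K" "p < S"
  shows "row_chain_dist i k p \<le> 2 * int M"
proof -
  have "\<bar>int p - (int L - int (\<alpha> i k div D))\<bar> \<le> 2 * int L"
    using assms \<alpha>_div_le[OF assms(1,2)] by (simp add: abs_le_iff)
  then have "int D * \<bar>int p - (int L - int (\<alpha> i k div D))\<bar> \<le> int D * (2 * int L)"
    by (intro mult_left_mono) auto
  moreover have "int (\<alpha> i k mod D) < int D" using D_pos by simp
  moreover have "int M = int D + int D * (2 * int L)" by (simp add: M_def)
  ultimately show ?thesis unfolding row_chain_dist_def by linarith
qed

lemma row_chain_dist_row_end:
  "i < n \<Longrightarrow> k < K \<Longrightarrow> row_chain_dist i k (L - \<alpha> i k div D) = int (M + \<alpha> i k mod D)"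
  using \<alpha>_div_le[of i k] by (simp add: row_chain_dist_def of_nat_diff)

lemma row_chain_dist_column_end:
  "row_chain_dist i k (L + \<beta> k j div D) + int (M + \<beta> k j mod D) = 2 * int M + int (\<alpha> i k + \<beta> k j)"
proof -
  have "int D * \<bar>int (L + \<beta> k j div D) - (int L - int (\<alpha> i k div D))\<bar>
      = int (D * (\<alpha> i k div D) + D * (\<beta> k j div D))"
    by (simp add: algebra_simps)
  moreover have "\<alpha> i k = D * (\<alpha> i k div D) + \<alpha> i k mod D" "\<beta> k j = D * (\<beta> k j div D) + \<beta> k j mod D"
    by simp_all
  ultimately show ?thesis unfolding row_chain_dist_def by linarith
qed

lemma row_chain_dist_Suc:
  "\<bar>row_chain_dist i k (Suc p) - row_chain_dist i k p\<bar> \<le> int D"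
proof -
  let ?z = "int L - int (\<alpha> i k div D)"
  have "\<bar>\<bar>int (Suc p) - ?z\<bar> - \<bar>int p - ?z\<bar>\<bar> \<le> 1" by linarith
  then have "int D * \<bar>\<bar>int (Suc p) - ?z\<bar> - \<bar>int p - ?z\<bar>\<bar> \<le> int D * 1"
    by (intro mult_left_mono) auto
  then show ?thesis
    by (simp add: row_chain_dist_def abs_mult flip: right_diff_distrib)
qed

lemma min_sum_le: "k < K \<Longrightarrow> min_sum i j \<le> \<alpha> i k + \<beta> k j"
  unfolding min_sum_def by (intro Min_le) auto

lemma min_sum_attained: obtains k where "k < K" "min_sum i j = \<alpha> i k + \<beta> k j"
proof -
  have "min_sum i j \<in> (\<lambda>k. \<alpha> i k + \<beta> k j) ` {..<K}"
    unfolding min_sum_def using K_pos by (intro Min_in) auto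
  then show thesis using that by auto
qed

lemma potential_link:
  assumes "i < n" "link x y = Some w"
  shows "\<bar>potential i y - potential i x\<bar> \<le> int w"
  using assms(2)
proof (cases rule: link_cases)
  case (row k)
  let ?p = "L - \<alpha> x k div D"
  have "?p < S" by simp
  then have y: "potential i y = row_chain_dist i k ?p" "row_chain_dist i k ?p \<le> 2 * int M"
    using row(2,3) potential_chain[OF assms(1)] row_chain_dist_le[OF assms(1)] by simp_all
  show ?thesis
  proof (cases "x = i")
    case True
    then show ?thesis using y row row_chain_dist_row_end by (simp add: potential_def)
  next
    case False
    then show ?thesis using y row row_chain_dist_ge[of i k ?p] by (simp add: potential_def)
  qed
next
  case (column j k)
  let ?p = "L + \<beta> k j div D"
  have "?p < S" using \<beta>_div_le[OF column(3,2)] by simp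
  then have "potential i y = row_chain_dist i k ?p" "row_chain_dist i k ?p \<le> 2 * int M"
    using column(3,4) potential_chain[OF assms(1)] row_chain_dist_le[OF assms(1)] by simp_all
  moreover have "potential i x = 2 * int M + int (min_sum i j)"
    using column assms(1) by (simp add: potential_def)
  ultimately show ?thesis
    using column row_chain_dist_column_end[of i k j] min_sum_le[OF column(3), of i j] by simp
next
  case (chain k p)
  then show ?thesis
    using row_chain_dist_Suc[of i k p] potential_chain[OF assms(1), of p k]
      potential_chain[OF assms(1), of "Suc p" k] by simp
qed

lemma potential_edge:
  assumes "i < n" "edge u v = Some w"
  shows "potential i v \<le> potential i u + int w"
  using potential_link[OF assms(1), of "min u v" "max u v" w] assms(2)
  by (cases "u \<le> v") (auto simp: edge_def min_def max_def)

lemma awalk_edge: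
  assumes "edge u v = Some w" "u < N" "v < N"
  shows "awalk u [(u, v)] v" "walk_cost [(u, v)] = real w"
proof -
  have "(u, v) \<in> parcs graph" using assms by (simp add: graph_def)
  then show "awalk u [(u, v)] v" using in_arcsD2[of u v] by (simp add: awalk_Cons_iff awalk_Nil_iff)
qed (use assms in \<open>simp add: weight_def\<close>)

lemma awalk_chain:
  assumes "k < K" "p + m < S"
  shows "\<exists>q. awalk (chain k p) q (chain k (p + m)) \<and> walk_cost q = real (D * m)"
  using assms(2)
proof (induction m)
  case 0
  then have "chain k p \<in> pverts graph" using chain_less[OF assms(1), of p] by (simp add: graph_def)
  then show ?case by (intro exI[of _ "[]"]) (simp add: awalk_Nil_iff)
next
  case (Suc m)
  let ?u = "chain k (p + m)" and ?v = "chain k (Suc (p + m))"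
  from Suc obtain q where q: "awalk (chain k p) q ?u" "walk_cost q = real (D * m)" by auto
  have "Suc (p + m) < S" using Suc.prems by simp
  then have "edge ?u ?v = Some D" "?u < N" "?v < N"
    using edge_chain[OF assms(1)] chain_less[OF assms(1)] by simp_all
  from awalk_edge[OF this] have e: "awalk ?u [(?u, ?v)] ?v" "walk_cost [(?u, ?v)] = real D" .
  show ?case using q(2) e(2) awalk_appendI[OF q(1) e(1)]
    by (intro exI[of _ "q @ [(?u, ?v)]"]) (auto simp: algebra_simps)
qed

lemma awalk_row_column:
  assumes "i < n" "j < n" "k < K"
  shows "\<exists>p. awalk i p (n + j) \<and> walk_cost p = real (2 * M + (\<alpha> i k + \<beta> k j))"
proof -
  let ?a = "\<alpha> i k div D" and ?b = "\<beta> k j div D"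
  let ?x = "chain k (L - ?a)" and ?y = "chain k (L + ?b)"
  have le: "?a \<le> L" "?b \<le> L" using \<alpha>_div_le \<beta>_div_le assms by auto
  have "L - ?a < S" "L + ?b < S" using le by auto
  then have less: "?x < N" "?y < N" using chain_less[OF assms(3)] by auto
  have bounds: "i < N" "n + j < N" using assms order by auto
  obtain q where q: "awalk ?x q ?y" "walk_cost q = real (D * (?a + ?b))"
    using awalk_chain[OF assms(3), of "L - ?a" "?a + ?b"] le by auto
  note row = awalk_edge[OF edge_row[OF assms(1,3)] bounds(1) less(1)]
  have "edge ?y (n + j) = Some (M + \<beta> k j mod D)"
    using edge_column[OF assms(2,3)] by (simp only: edge_commute)
  note column = awalk_edge[OF this less(2) bounds(2)]
  have "D * (?a + ?b) + (\<alpha> i k mod D + \<beta> k j mod D) = \<alpha> i k + \<beta> k j"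
    using mult_div_mod_eq[of D "\<alpha> i k"] mult_div_mod_eq[of D "\<beta> k j"]
    unfolding distrib_left by linarith
  then have "(M + \<alpha> i k mod D) + (D * (?a + ?b) + (M + \<beta> k j mod D)) = 2 * M + (\<alpha> i k + \<beta> k j)"
    by linarith
  then have "walk_cost ([(i, ?x)] @ q @ [(?y, n + j)]) = real (2 * M + (\<alpha> i k + \<beta> k j))"
    unfolding awalk_cost_append row(2) q(2) column(2) by (simp only: of_nat_add[symmetric])
  moreover have "awalk i ([(i, ?x)] @ q @ [(?y, n + j)]) (n + j)"
    using row(1) q(1) column(1) by (blast intro: awalk_appendI)
  ultimately show ?thesis by blast
qed

theorem distance_row_column:
  assumes "i < n" "j < n"
  shows "distance graph weight i (n + j) = ereal (real (2 * M + min_sum i j))"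
proof (rule antisym)
  obtain k where k: "k < K" "min_sum i j = \<alpha> i k + \<beta> k j" by (rule min_sum_attained)
  obtain p where "awalk i p (n + j)" "walk_cost p = real (2 * M + min_sum i j)"
    using awalk_row_column[OF assms k(1)] k(2) by auto
  then show "distance graph weight i (n + j) \<le> ereal (real (2 * M + min_sum i j))"
    using min_cost_le_walk_cost by metis
next
  have "ereal (real_of_int (potential i (n + j)) - real_of_int (potential i i))
      \<le> distance graph weight i (n + j)"
  proof (rule potential_le_\<mu>)
    fix e assume "e \<in> parcs graph"
    then obtain u v w where "e = (u, v)" "edge u v = Some w" by (auto simp: graph_def)
    with potential_edge[OF assms(1), of u v w]
    show "real_of_int (potential i (snd e))
        \<le> real_of_int (potential i (fst e)) + real_of_int (weight e)"
      by (simp add: weight_def)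
  qed
  then show "ereal (real (2 * M + min_sum i j)) \<le> distance graph weight i (n + j)"
    using assms by (simp add: potential_def)
qed

end

section \<open>The reduction program\<close>

abbreviation Plus :: "'v aexp \<Rightarrow> 'v aexp \<Rightarrow> 'v aexp" (infixl "\<^bold>+" 65) where "x \<^bold>+ y \<equiv> Bin Add x y"
abbreviation Minus :: "'v aexp \<Rightarrow> 'v aexp \<Rightarrow> 'v aexp" (infixl "\<^bold>-" 65) where "x \<^bold>- y \<equiv> Bin Sub x y"
abbreviation Times :: "'v aexp \<Rightarrow> 'v aexp \<Rightarrow> 'v aexp" (infixl "\<^bold>*" 70) where "x \<^bold>* y \<equiv> Bin Mul x y"
abbreviation Quot :: "'v aexp \<Rightarrow> 'v aexp \<Rightarrow> 'v aexp" (infixl "\<^bold>'/" 70) where "x \<^bold>/ y \<equiv> Bin Div x y"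
abbreviation Rem :: "'v aexp \<Rightarrow> 'v aexp \<Rightarrow> 'v aexp" (infixl "\<^bold>%" 70) where "x \<^bold>% y \<equiv> Bin Mod x y"
abbreviation Then :: "'v stm \<Rightarrow> 'v stm \<Rightarrow> 'v stm" (infixr "\<^bold>;" 60) where "c \<^bold>; d \<equiv> Comp c d"

text \<open>
  The variables \<open>Vn\<close> to \<open>VN\<close> hold the parameters of the graph and \<open>VE\<close> holds \<open>N * N\<close>, the number of
  adjacency matrix entries. \<open>Vb\<close> and \<open>Vw\<close> are the two words of the current entry.
\<close>

datatype var = Vn | VK | VD | VL | VS | VM | VN | VE | Ve | Vx | Vy | Vk | Vp | Vz | Vb | Vw

instance var :: finite
proof
  have "UNIV = {Vn, VK, VD, VL, VS, VM, VN, VE, Ve, Vx, Vy, Vk, Vp, Vz, Vb, Vw}"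
    by (auto intro: var.exhaust)
  then show "finite (UNIV :: var set)" by (metis finite.emptyI finite_insert)
qed

definition setup_stm :: "var stm" where
  "setup_stm =
     Assign Vn (Mem (Num 0)) \<^bold>;
     Assign VK (Mem (Num 1)) \<^bold>;
     Assign VD (Var VK \<^bold>* Var VK \<^bold>/ Var Vn \<^bold>- Num 1) \<^bold>;
     Cond Lt (Var VD) (Num 1) (Assign VD (Num 1)) Nop \<^bold>;
     Assign VL (Num 2 \<^bold>* Var VK \<^bold>/ Var VD) \<^bold>;
     Assign VS (Num 2 \<^bold>* Var VL \<^bold>+ Num 1) \<^bold>;
     Assign VM (Var VD \<^bold>* Var VS) \<^bold>;
     Assign VN (Num 15 \<^bold>* Var Vn) \<^bold>;
     Assign VE (Var VN \<^bold>* Var VN)"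

definition endpoints_stm :: "var stm" where
  "endpoints_stm =
     Cond Lt (Var Ve \<^bold>/ Var VN) (Var Ve \<^bold>% Var VN)
       (Assign Vx (Var Ve \<^bold>/ Var VN) \<^bold>; Assign Vy (Var Ve \<^bold>% Var VN))
       (Assign Vx (Var Ve \<^bold>% Var VN) \<^bold>; Assign Vy (Var Ve \<^bold>/ Var VN)) \<^bold>;
     Assign Vb (Num 0) \<^bold>;
     Assign Vw (Num 0)"

definition attach_stm :: "var aexp \<Rightarrow> var stm" where
  "attach_stm q =
     Cond Eq (Var Vp) q (Assign Vb (Num 1) \<^bold>; Assign Vw (Var VM \<^bold>+ Var Vz \<^bold>% Var VD)) Nop"

definition entry_stm :: "var aexp \<Rightarrow> var aexp \<Rightarrow> var stm" where
  "entry_stm a q = Assign Vz (Mem a \<^bold>+ Var VK) \<^bold>; attach_stm q"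

definition row_stm :: "var stm" where
  "row_stm = entry_stm (Num 3 \<^bold>+ Var Vx \<^bold>* Var VK \<^bold>+ Var Vk) (Var VL \<^bold>- Var Vz \<^bold>/ Var VD)"

definition column_stm :: "var stm" where
  "column_stm =
     entry_stm (Num 3 \<^bold>+ Var Vn \<^bold>* Var VK \<^bold>+ Var Vk \<^bold>* Var Vn \<^bold>+ (Var Vx \<^bold>- Var Vn))
       (Var VL \<^bold>+ Var Vz \<^bold>/ Var VD)"

definition chain_stm :: "var stm" where
  "chain_stm =
     Cond Eq (Var Vx \<^bold>+ Num 1) (Var Vy)
       (Cond Lt (Num 0) (Var Vp) (Assign Vb (Num 1) \<^bold>; Assign Vw (Var VD)) Nop) Nop"

definition link_at_stm :: "var stm" where
  "link_at_stm =
     Cond Lt (Var Vk) (Var VK)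
       (Cond Lt (Var Vx) (Var Vn) row_stm
         (Cond Lt (Var Vx) (Num 2 \<^bold>* Var Vn) column_stm chain_stm))
       Nop"

definition link_stm :: "var stm" where
  "link_stm =
     Cond Lt (Var Vy) (Num 2 \<^bold>* Var Vn) Nop (
       Assign Vk ((Var Vy \<^bold>- Num 2 \<^bold>* Var Vn) \<^bold>/ Var VS) \<^bold>;
       Assign Vp ((Var Vy \<^bold>- Num 2 \<^bold>* Var Vn) \<^bold>% Var VS) \<^bold>;
       link_at_stm)"

definition write_stm :: "var stm" where
  "write_stm =
     Write (Num 2 \<^bold>* Var VE \<^bold>+ Num 1 \<^bold>+ Num 2 \<^bold>* Var Ve) (Var Vb) \<^bold>;
     Write (Num 2 \<^bold>* Var VE \<^bold>+ Num 1 \<^bold>+ Num 2 \<^bold>* Var Ve \<^bold>+ Num 1) (Var Vw)"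

text \<open>
  The adjacency matrix overlaps the input, so it is first built behind its final position and
  moved only when the input is no longer needed. The move also clears the memory behind it.
\<close>

definition build_stm :: "var stm" where
  "build_stm = endpoints_stm \<^bold>; link_stm \<^bold>; write_stm"

definition move_stm :: "var stm" where
  "move_stm =
     Write (Var Ve \<^bold>+ Num 1) (Mem (Num 2 \<^bold>* Var VE \<^bold>+ Num 1 \<^bold>+ Var Ve)) \<^bold>;
     Write (Num 2 \<^bold>* Var VE \<^bold>+ Num 1 \<^bold>+ Var Ve) (Num 0)"

definition encode_stm :: "var stm" where
  "encode_stm =
     setup_stm \<^bold>;
     For Ve (Var VE) build_stm \<^bold>;
     For Ve (Num 2 \<^bold>* Var VE) move_stm \<^bold>;
     Write (Num 0) (Var VN)"

text \<open>
  The cell read in iteration \<open>e\<close> has an address greater than \<open>e\<close>, so the output may overwrite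
  the distance matrix from below.
\<close>

definition read_stm :: "var stm" where
  "read_stm =
     Assign Vx (Var Ve \<^bold>/ Var Vn) \<^bold>;
     Assign Vy (Var Ve \<^bold>% Var Vn) \<^bold>;
     Write (Var Ve)
       (Mem (Num 2 \<^bold>* (Var Vx \<^bold>* Var VN \<^bold>+ (Var Vn \<^bold>+ Var Vy)) \<^bold>+ Num 1)
         \<^bold>- Num 2 \<^bold>* Var VM \<^bold>- Num 2 \<^bold>* Var VK)"

definition decode_stm :: "var stm" where
  "decode_stm = For Ve (Var Vn \<^bold>* Var Vn) read_stm"

section \<open>Choice of the parameters\<close>

text \<open>
  The quotient \<open>K * K div n\<close> approximates \<open>n powr \<gamma>\<close> up to a constant factor. Unlike \<open>\<gamma>\<close>, which may
  be an uncomputable real number, it can be computed from the dimensions in the input.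
\<close>

definition block_size :: "nat \<Rightarrow> nat \<Rightarrow> nat" where
  "block_size n K = max 1 (K * K div n - 1)"

lemma block_size_pos: "0 < block_size n K"
  by (simp add: block_size_def)

lemma block_size_le:
  assumes "0 < K" "K \<le> n"
  shows "block_size n K \<le> K"
proof -
  have "K * K div n \<le> K * n div n" using assms by (intro div_le_mono) simp
  then show ?thesis using assms by (simp add: block_size_def)
qed

lemma gadget_order_le:
  assumes "0 < K" "K \<le> n"
  shows "2 * n + K * Suc (2 * (2 * K div block_size n K)) \<le> 15 * n"
proof -
  let ?D = "block_size n K" and ?L = "2 * K div block_size n K"
  have n: "0 < n" using assms by simp
  have "K * K div n + 1 \<le> 3 * ?D" unfolding block_size_def by linarith
  then have "n * (K * K div n + 1) \<le> n * (3 * ?D)" by (rule mult_le_mono2)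
  moreover have "K * K < n * (K * K div n + 1)"
    using dividend_less_times_div[OF n, of "K * K"] by (simp add: algebra_simps)
  ultimately have K_square_le: "K * K \<le> 3 * n * ?D" by (simp add: algebra_simps)
  have "K * (?L * ?D) \<le> K * (2 * K)" by (intro mult_le_mono2 div_times_less_eq_dividend)
  also have "K * (2 * K) \<le> 6 * n * ?D" using K_square_le by linarith
  finally have "(K * ?L) * ?D \<le> (6 * n) * ?D" by (simp only: mult.assoc)
  then have "K * ?L \<le> 6 * n" using block_size_pos by simp
  then show ?thesis using assms(2) by (simp add: algebra_simps)
qed

locale min_plus_instance =
  fixes n K :: nat and X Y :: "int mat"
  assumes K: "0 < K" "K \<le> n"
    and X: "X \<in> carrier_mat n K" and Y: "Y \<in> carrier_mat K n"
    and X_bounded: "\<And>i k. i < n \<Longrightarrow> k < K \<Longrightarrow> \<bar>X $$ (i, k)\<bar> \<le> int K"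
    and Y_bounded: "\<And>k j. k < K \<Longrightarrow> j < n \<Longrightarrow> \<bar>Y $$ (k, j)\<bar> \<le> int K"
begin

definition D :: nat where "D = block_size n K"
definition B :: nat where "B = 2 * K"
definition N :: nat where "N = 15 * n"
definition \<alpha> :: "nat \<Rightarrow> nat \<Rightarrow> nat" where "\<alpha> i k = nat (X $$ (i, k) + int K)"
definition \<beta> :: "nat \<Rightarrow> nat \<Rightarrow> nat" where "\<beta> k j = nat (Y $$ (k, j) + int K)"

lemma \<alpha>_eq: "i < n \<Longrightarrow> k < K \<Longrightarrow> int (\<alpha> i k) = X $$ (i, k) + int K"
  using X_bounded[of i k] by (simp add: \<alpha>_def)

lemma \<beta>_eq: "k < K \<Longrightarrow> j < n \<Longrightarrow> int (\<beta> k j) = Y $$ (k, j) + int K"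
  using Y_bounded[of k j] by (simp add: \<beta>_def)

sublocale min_plus_gadget n K D B N \<alpha> \<beta>
proof
  show "0 < K" "0 < D" "2 * n + K * Suc (2 * (B div D)) \<le> N"
    using K block_size_pos gadget_order_le[OF K] by (simp_all add: D_def B_def N_def)
  show "\<alpha> i k \<le> B" if "i < n" "k < K" for i k
    using \<alpha>_eq[OF that] X_bounded[OF that] unfolding B_def by linarith
  show "\<beta> k j \<le> B" if "k < K" "j < n" for k j
    using \<beta>_eq[OF that] Y_bounded[OF that] unfolding B_def by linarith
qed

lemma min_plus_product_eq:
  assumes "i < n" "j < n"
  shows "min_plus_product X Y $$ (i, j) = int (min_sum i j) - 2 * int K"
proof -
  have "min_plus_product X Y $$ (i, j) = Min ((\<lambda>k. X $$ (i, k) + Y $$ (k, j)) ` {..<K})"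
    using X Y assms by (auto simp: min_plus_product_def)
  also have "\<dots> = int (min_sum i j) - 2 * int K"
  proof (rule Min_eqI)
    show "int (min_sum i j) - 2 * int K \<le> y" if "y \<in> (\<lambda>k. X $$ (i, k) + Y $$ (k, j)) ` {..<K}" for y
      using that min_sum_le[of _ i j] \<alpha>_eq[OF assms(1)] \<beta>_eq[OF _ assms(2)] by fastforce
    obtain k where "k < K" "min_sum i j = \<alpha> i k + \<beta> k j" by (rule min_sum_attained)
    then show "int (min_sum i j) - 2 * int K \<in> (\<lambda>k. X $$ (i, k) + Y $$ (k, j)) ` {..<K}"
      using \<alpha>_eq[OF assms(1)] \<beta>_eq[OF _ assms(2)] by (intro image_eqI[of _ _ k]) auto
  qed simp
  finally show ?thesis .
qed

end

section \<open>Memory layout\<close>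

lemma mult_add_less:
  fixes i j m l :: nat
  assumes "i < m" "j < l"
  shows "i * l + j < m * l"
  using mult_le_mono1[of "Suc i" m l] assms by simp

lemma length_concat_uniform:
  assumes "\<And>i. i < m \<Longrightarrow> length (f i) = l"
  shows "length (concat (map f [0..<m])) = m * l"
  using assms by (induction m) auto

lemma nth_concat_uniform:
  assumes "\<And>i. i < m \<Longrightarrow> length (f i) = l" "i < m" "j < l"
  shows "concat (map f [0..<m]) ! (i * l + j) = f i ! j"
  using assms
proof (induction m)
  case (Suc m)
  have length_prefix: "length (concat (map f [0..<m])) = m * l"
    using Suc.prems by (intro length_concat_uniform) auto
  show ?case
  proof (cases "i < m")
    case True
    then show ?thesis using Suc length_prefix mult_add_less[of i m j l] by (simp add: nth_append)
  next
    case False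
    then have "i = m" using Suc.prems(2) by simp
    then show ?thesis using Suc.prems length_prefix by (simp add: nth_append)
  qed
qed simp

lemma length_row_major: "A \<in> carrier_mat m l \<Longrightarrow> length (row_major A) = m * l"
  unfolding row_major_def by (subst length_concat_uniform[of _ _ l]) auto

lemma nth_row_major:
  assumes "A \<in> carrier_mat m l" "i < m" "j < l"
  shows "row_major A ! (i * l + j) = A $$ (i, j)"
  unfolding row_major_def using assms by (subst nth_concat_uniform[where l = l]) auto

context min_plus_instance
begin

definition input_mem :: "nat \<Rightarrow> int" where
  "input_mem = mem (init_state (min_plus_input (X, Y)))"

abbreviation base :: nat where "base \<equiv> 2 * (N * N) + 1"

lemma input_mem_dims: "input_mem 0 = int n" "input_mem 1 = int K"
  using X Y by (simp_all add: input_mem_def init_state_def)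

lemma input_mem_X:
  assumes "i < n" "k < K"
  shows "input_mem (3 + i * K + k) + int K = int (\<alpha> i k)"
  using X Y nth_row_major[OF X assms] mult_add_less[OF assms]
  by (simp add: input_mem_def init_state_def \<alpha>_eq[OF assms] length_row_major nth_append nth_Cons')

lemma input_mem_Y:
  assumes "k < K" "j < n"
  shows "input_mem (3 + n * K + k * n + j) + int K = int (\<beta> k j)"
  using X Y nth_row_major[OF Y assms] mult_add_less[OF assms]
  by (simp add: input_mem_def init_state_def \<beta>_eq[OF assms] length_row_major nth_append nth_Cons')

lemma input_length_le: "3 + n * K + K * n \<le> base"
proof -
  have "n * K \<le> n * n" "K * n \<le> n * n" "0 < n * n" using K by simp_all
  moreover have "N * N = 225 * (n * n)" by (simp add: N_def)
  ultimately show ?thesis by linarith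
qed

lemma input_mem_zero:
  assumes "base \<le> a"
  shows "input_mem a = 0"
proof -
  have "length (min_plus_input (X, Y)) = 3 + n * K + K * n"
    using X Y by (simp add: length_row_major)
  then have "length (min_plus_input (X, Y)) \<le> a" using input_length_le assms by linarith
  then show ?thesis by (simp add: input_mem_def init_state_def)
qed

definition flag_word :: "nat option \<Rightarrow> int" where
  "flag_word w = (case w of None \<Rightarrow> 0 | Some _ \<Rightarrow> 1)"

definition weight_word :: "nat option \<Rightarrow> int" where
  "weight_word w = (case w of None \<Rightarrow> 0 | Some x \<Rightarrow> int x)"

definition cell :: "nat \<Rightarrow> int" where
  "cell c = (if even c then flag_word else weight_word) (edge (c div 2 div N) (c div 2 mod N))"

lemma apsp_input_mem:
  "mem (init_state (apsp_input (graph, weight))) =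
     (\<lambda>a. if a = 0 then int N else if a < base then cell (a - 1) else 0)"
proof -
  let ?entry = "\<lambda>u v. if (u, v) \<in> parcs graph then [1, weight (u, v)] else [0, 0]"
  let ?row = "\<lambda>u. concat (map (?entry u) [0..<N])"
  let ?adj = "concat (map ?row [0..<N])"
  have input_eq: "apsp_input (graph, weight) = int N # ?adj" by (simp add: graph_def Let_def)
  have entry: "length (?entry u v) = 2" for u v by simp
  have row: "length (?row u) = N * 2" for u by (rule length_concat_uniform) (rule entry)
  have length_adj: "length ?adj = N * (N * 2)" by (rule length_concat_uniform) (rule row)
  have "?adj ! c = cell c" if c: "c < 2 * (N * N)" for c
  proof -
    define u v where "u = c div 2 div N" and "v = c div 2 mod N"
    have N: "0 < N" using K by (simp add: N_def)
    then have uv: "u < N" "v < N"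
      using c by (auto simp: u_def v_def less_mult_imp_div_less)
    have "c = c div 2 * 2 + c mod 2" "c div 2 = u * N + v" by (simp_all add: u_def v_def)
    then have "?adj ! c = ?adj ! (u * (N * 2) + (v * 2 + c mod 2))"
      by (simp add: algebra_simps)
    also have "\<dots> = ?row u ! (v * 2 + c mod 2)"
      using uv by (intro nth_concat_uniform[OF row] mult_add_less) auto
    also have "\<dots> = ?entry u v ! (c mod 2)"
      using uv by (intro nth_concat_uniform[OF entry]) auto
    also have "\<dots> = cell c"
      using uv by (cases "edge u v"; cases "even c")
        (auto simp: cell_def flag_word_def weight_word_def graph_def weight_def u_def v_def
          odd_iff_mod_2_eq_one)
    finally show ?thesis .
  qed
  then show ?thesis unfolding input_eq
    by (auto simp: init_state_def length_adj nth_Cons' fun_eq_iff simp del: map_map)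
qed

definition built_mem :: "nat \<Rightarrow> nat \<Rightarrow> int" where
  "built_mem i a = (if base \<le> a \<and> a < base + 2 * i then cell (a - base) else input_mem a)"

definition moved_mem :: "nat \<Rightarrow> nat \<Rightarrow> int" where
  "moved_mem i a = (if 0 < a \<and> a \<le> i then cell (a - 1) else if base \<le> a \<and> a < base + i then 0
     else built_mem (N * N) a)"

lemma built_mem_0: "built_mem 0 = input_mem"
  by (simp add: built_mem_def fun_eq_iff)

lemma built_mem_Suc:
  "(built_mem i)(base + 2 * i := cell (2 * i), base + 2 * i + 1 := cell (2 * i + 1))
    = built_mem (Suc i)"
proof
  fix a
  consider "a = base + 2 * i" | "a = base + 2 * i + 1" | "a < base + 2 * i" | "base + 2 * i + 1 < a"
    by linarith
  then show "((built_mem i)(base + 2 * i := cell (2 * i), base + 2 * i + 1 := cell (2 * i + 1))) a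
      = built_mem (Suc i) a"
    by cases (simp_all add: built_mem_def)
qed

lemma moved_mem_0: "moved_mem 0 = built_mem (N * N)"
  by (simp add: moved_mem_def fun_eq_iff)

lemma moved_mem_Suc:
  assumes "i < 2 * (N * N)"
  shows "(moved_mem i)(i + 1 := cell i, base + i := 0) = moved_mem (Suc i)"
proof
  fix a
  consider "a = i + 1" | "a = base + i" | "a \<noteq> i + 1" "a \<noteq> base + i" by linarith
  then show "((moved_mem i)(i + 1 := cell i, base + i := 0)) a = moved_mem (Suc i) a"
    using assms by cases (auto simp: moved_mem_def)
qed

lemma moved_mem_next: "i < 2 * (N * N) \<Longrightarrow> moved_mem i (base + i) = cell i"
  by (simp add: moved_mem_def built_mem_def)

lemma moved_mem_all:
  "(moved_mem (2 * (N * N)))(0 := int N) = mem (init_state (apsp_input (graph, weight)))"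
  unfolding apsp_input_mem
  by (auto simp: moved_mem_def built_mem_def input_mem_zero fun_eq_iff)

end

section \<open>Correctness of the reduction program\<close>

context min_plus_instance
begin

definition params :: "var store \<Rightarrow> bool" where
  "params \<sigma> \<longleftrightarrow> vars \<sigma> Vn = int n \<and> vars \<sigma> VK = int K \<and> vars \<sigma> VD = int D \<and> vars \<sigma> VL = int L \<and>
     vars \<sigma> VS = int S \<and> vars \<sigma> VM = int M \<and> vars \<sigma> VN = int N \<and> vars \<sigma> VE = int N * int N"

definition at_entry :: "nat \<Rightarrow> (nat \<Rightarrow> int) \<Rightarrow> nat option \<Rightarrow> var store \<Rightarrow> bool" where
  "at_entry e H w \<sigma> \<longleftrightarrow> params \<sigma> \<and> vars \<sigma> Ve = int e \<and> heap \<sigma> = H \<and>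
     vars \<sigma> Vb = flag_word w \<and> vars \<sigma> Vw = weight_word w"

lemma D_le: "D \<le> K"
  unfolding D_def by (rule block_size_le[OF K])

lemma D_eq: "int D = (if int K * int K div int n - 1 < 1 then 1 else int K * int K div int n - 1)"
proof -
  have "int K * int K div int n = int (K * K div n)" by (simp add: of_nat_div)
  then show ?thesis by (auto simp: D_def block_size_def max_def of_nat_diff)
qed

lemma L_eq: "L = 2 * K div D"
  unfolding L_def unfolding B_def ..

lemma size_bounds:
  "int N = 15 * int n" "int N * int N = 225 * (int n * int n)" "int n \<le> int n * int n" "0 < int n"
  "int K \<le> int n" "0 < int K" "int D \<le> int K" "0 < int D" "int L \<le> 2 * int K" "int M \<le> 5 * int K"
  "int K * int K \<le> int n * int n" "int n * int K \<le> int n * int n"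
proof -
  show "int N = 15 * int n" "int N * int N = 225 * (int n * int n)" by (simp_all add: N_def)
  show n: "0 < int n" using K by simp
  show "int n \<le> int n * int n" using n by (simp add: mult_le_cancel_left1)
  show "int K \<le> int n" "0 < int K" "int D \<le> int K" "0 < int D" using K D_le D_pos by auto
  have "L \<le> 2 * K" unfolding L_eq by (rule div_le_dividend)
  then show "int L \<le> 2 * int K" by linarith
  have "D * L \<le> 2 * K" unfolding L_eq by simp
  then have "M \<le> 5 * K" using D_le by (simp add: M_def)
  then show "int M \<le> 5 * int K" by linarith
  show "int K * int K \<le> int n * int n" "int n * int K \<le> int n * int n"
    using K by (auto intro!: mult_mono)
qed

lemma nat_base_add:
  "nat (2 * (int N * int N) + 1 + int c) = base + c"
  by (simp add: nat_add_distrib nat_mult_distrib)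

context
  fixes W :: int
  assumes W: "6 * (int N * int N) < W"
begin

lemmas bounds = size_bounds W

lemma W_greater: "2 < W" "int N * int N < W" "2 * (int N * int N) < W"
  using bounds by linarith+

lemma wp_setup:
  assumes "heap \<sigma> = input_mem"
  shows "wp W m setup_stm (\<lambda>\<sigma>. params \<sigma> \<and> heap \<sigma> = input_mem) \<sigma>"
proof -
  define d where "d = int K * int K div int n"
  have d: "0 \<le> d" "d \<le> int n * int n"
  proof -
    show "0 \<le> d" using bounds(4) by (simp add: d_def pos_imp_zdiv_nonneg_iff)
    have "d \<le> int K * int K"
      using div_le_dividend[of "K * K" n] by (simp add: d_def flip: of_nat_mult of_nat_div)
    then show "d \<le> int n * int n" using bounds by linarith
  qed
  have L: "2 * int K div int D = int L" by (simp add: L_eq of_nat_div)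
  have M: "int D * (2 * int L + 1) = int M" by (simp add: M_def algebra_simps)
  show ?thesis
    using assms input_mem_dims D_eq bounds(1) d L M
    by (cases "d - 1 < 1")
      (simp_all add: setup_stm_def params_def d_def[symmetric] input_mem_dims(2)[simplified];
        intro conjI; use bounds in linarith)+
qed

lemma wp_endpoints:
  assumes "params \<sigma>" "vars \<sigma> Ve = int e" "e < N * N"
  shows "wp W m endpoints_stm (\<lambda>\<sigma>'. at_entry e (heap \<sigma>) None \<sigma>' \<and>
    vars \<sigma>' Vx = int (min (e div N) (e mod N)) \<and> vars \<sigma>' Vy = int (max (e div N) (e mod N))) \<sigma>"
proof -
  define u v where "u = e div N" and "v = e mod N"
  have e: "int e < int N * int N" using assms(3) by (simp flip: of_nat_mult)
  have quotients: "int e div int N = int u" "int e mod int N = int v"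
    by (simp_all add: u_def v_def of_nat_div of_nat_mod)
  have "u \<le> e" "v \<le> e" unfolding u_def v_def by simp_all
  then have "int u \<le> int e" "int v \<le> int e" by simp_all
  then show ?thesis
    using assms(1,2) unfolding u_def[symmetric] v_def[symmetric]
    by (cases "u < v";
        simp add: endpoints_stm_def at_entry_def params_def quotients flag_word_def weight_word_def;
        intro conjI; use bounds e in linarith)
qed

lemma wp_attach:
  assumes "at_entry e H None \<sigma>" "vars \<sigma> Vp = int p" "vars \<sigma> Vz = int z" "int p < W" "int z < W"
    and q: "asafe W q \<sigma>" "aval q \<sigma> = int r"
  shows "wp W m (attach_stm q) (at_entry e H (if p = r then Some (M + z mod D) else None)) \<sigma>"
proof -
  have "z mod D < D" using D_pos by simp
  then have "int (z mod D) \<le> int D" by simp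
  moreover have "int z mod int D = int (z mod D)" by (simp add: of_nat_mod)
  ultimately show ?thesis
    using assms unfolding attach_stm_def
    by (cases "p = r"; simp add: at_entry_def params_def flag_word_def weight_word_def;
        intro conjI; use bounds in linarith)
qed

lemma wp_entry:
  assumes \<sigma>: "at_entry e H None \<sigma>" "vars \<sigma> Vp = int p" "p < S"
    and addr: "asafe W a \<sigma>" "aval a \<sigma> = int c"
    and z: "H c + int K = int z" "z \<le> B"
    and q: "\<And>\<tau>. at_entry e H None \<tau> \<Longrightarrow> vars \<tau> Vz = int z \<Longrightarrow> asafe W q \<tau> \<and> aval q \<tau> = int r"
  shows "wp W m (entry_stm a q) (at_entry e H (if p = r then Some (M + z mod D) else None)) \<sigma>"
proof -
  have "int z \<le> 2 * int K" using z(2) by (simp add: B_def)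
  then have "\<bar>H c\<bar> < W" "int K < W" "int z < W" "int p < W"
    using \<sigma>(3) z(1) bounds by linarith+
  then have "wp W m (Assign Vz (Mem a \<^bold>+ Var VK))
      (\<lambda>\<tau>. at_entry e H None \<tau> \<and> vars \<tau> Vp = int p \<and> vars \<tau> Vz = int z) \<sigma>"
    using \<sigma> addr z(1) by (simp add: at_entry_def params_def)
  then show ?thesis unfolding entry_stm_def
  proof (rule wp_Comp)
    fix \<tau> assume "at_entry e H None \<tau> \<and> vars \<tau> Vp = int p \<and> vars \<tau> Vz = int z"
    then show "wp W m (attach_stm q) (at_entry e H (if p = r then Some (M + z mod D) else None)) \<tau>"
      using q \<open>int p < W\<close> \<open>int z < W\<close> by (intro wp_attach) auto
  qed
qed

lemma wp_row:
  assumes \<sigma>: "at_entry e H None \<sigma>" "vars \<sigma> Vx = int x" "vars \<sigma> Vk = int k" "vars \<sigma> Vp = int p"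
    and xk: "x < n" "k < K" and "p < S" and H: "\<And>a. a < base \<Longrightarrow> H a = input_mem a"
  shows "wp W m row_stm
    (at_entry e H (if p = L - \<alpha> x k div D then Some (M + \<alpha> x k mod D) else None)) \<sigma>"
  unfolding row_stm_def
proof (rule wp_entry[OF \<sigma>(1,4) assms(7)])
  let ?a = "Num 3 \<^bold>+ Var Vx \<^bold>* Var VK \<^bold>+ Var Vk" and ?q = "Var VL \<^bold>- Var Vz \<^bold>/ Var VD"
  have less: "x * K + k < n * K" using xk by (rule mult_add_less)
  then have address: "int x * int K + int k < int n * int K" "0 \<le> int x * int K" "int x < int n"
    using xk(1) by (simp_all flip: of_nat_mult of_nat_add)
  show "asafe W ?a \<sigma>" "aval ?a \<sigma> = int (3 + x * K + k)"
    using \<sigma> by (simp_all add: at_entry_def params_def) (intro conjI; use bounds address in linarith)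
  have "3 + x * K + k < base" using less input_length_le by linarith
  then show "H (3 + x * K + k) + int K = int (\<alpha> x k)" using H input_mem_X[OF xk] by simp
  show "\<alpha> x k \<le> B" using xk by (rule \<alpha>_le)
  then have "int (\<alpha> x k) \<le> 2 * int K" by (simp add: B_def)
  moreover have "int (\<alpha> x k) div int D = int (\<alpha> x k div D)" by (simp add: of_nat_div)
  moreover have "\<alpha> x k div D \<le> L" using xk by (rule \<alpha>_div_le)
  ultimately show "asafe W ?q \<tau> \<and> aval ?q \<tau> = int (L - \<alpha> x k div D)"
    if "at_entry e H None \<tau>" "vars \<tau> Vz = int (\<alpha> x k)" for \<tau>
    using that
    by (simp add: at_entry_def params_def of_nat_diff; intro conjI; use bounds in linarith)
qed

lemma wp_column:
  assumes \<sigma>: "at_entry e H None \<sigma>" "vars \<sigma> Vx = int (n + j)" "vars \<sigma> Vk = int k" "vars \<sigma> Vp = int p"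
    and kj: "k < K" "j < n" and "p < S" and H: "\<And>a. a < base \<Longrightarrow> H a = input_mem a"
  shows "wp W m column_stm
    (at_entry e H (if p = L + \<beta> k j div D then Some (M + \<beta> k j mod D) else None)) \<sigma>"
  unfolding column_stm_def
proof (rule wp_entry[OF \<sigma>(1,4) assms(7)])
  let ?a = "Num 3 \<^bold>+ Var Vn \<^bold>* Var VK \<^bold>+ Var Vk \<^bold>* Var Vn \<^bold>+ (Var Vx \<^bold>- Var Vn)"
    and ?q = "Var VL \<^bold>+ Var Vz \<^bold>/ Var VD"
  have less: "k * n + j < K * n" using kj by (rule mult_add_less)
  then have address: "int k * int n + int j < int n * int K" "0 \<le> int k * int n" "0 \<le> int n * int K"
      "int k < int K" "int j < int n"
    using kj by (simp_all add: mult.commute flip: of_nat_mult of_nat_add)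
  show "asafe W ?a \<sigma>" "aval ?a \<sigma> = int (3 + n * K + k * n + j)"
    using \<sigma> by (simp_all add: at_entry_def params_def) (intro conjI; use bounds address in linarith)
  have "3 + n * K + k * n + j < base" using less input_length_le by linarith
  then show "H (3 + n * K + k * n + j) + int K = int (\<beta> k j)" using H input_mem_Y[OF kj] by simp
  show "\<beta> k j \<le> B" using kj by (rule \<beta>_le)
  then have "int (\<beta> k j) \<le> 2 * int K" by (simp add: B_def)
  moreover have "int (\<beta> k j) div int D = int (\<beta> k j div D)" by (simp add: of_nat_div)
  moreover have "\<beta> k j div D \<le> L" using kj by (rule \<beta>_div_le)
  ultimately show "asafe W ?q \<tau> \<and> aval ?q \<tau> = int (L + \<beta> k j div D)"
    if "at_entry e H None \<tau>" "vars \<tau> Vz = int (\<beta> k j)" for \<tau>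
    using that by (simp add: at_entry_def params_def; intro conjI; use bounds in linarith)
qed

lemma wp_chain:
  assumes "at_entry e H None \<sigma>" "vars \<sigma> Vx = int x" "vars \<sigma> Vy = int y" "vars \<sigma> Vp = int p"
    and "x < N" "y < N" "p < S"
  shows "wp W m chain_stm (at_entry e H (if x + 1 = y \<and> 0 < p then Some D else None)) \<sigma>"
proof -
  have "int x < int N" "int y < int N" "int p \<le> 2 * int L" using assms(5-7) by auto
  then show ?thesis
    using assms(1-4) unfolding chain_stm_def
    by (cases "x + 1 = y"; cases "0 < p";
        simp add: at_entry_def params_def flag_word_def weight_word_def;
        (intro conjI)?; (use bounds in linarith)?)
qed

lemma wp_link_at:
  assumes \<sigma>: "at_entry e H None \<sigma>" "vars \<sigma> Vx = int x" "vars \<sigma> Vy = int y"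
      "vars \<sigma> Vk = int (chain_index y)" "vars \<sigma> Vp = int (chain_position y)"
    and "x < N" "y < N" "2 * n \<le> y" and H: "\<And>a. a < base \<Longrightarrow> H a = input_mem a"
  shows "wp W m link_at_stm (at_entry e H (link x y)) \<sigma>"
proof -
  let ?k = "chain_index y"
  note link = link_def[of x y, unfolded Let_def]
  have "?k \<le> y" unfolding chain_index_def by (metis diff_le_self div_le_dividend order_trans)
  then have safe: "int ?k < W" "int x < W" "2 * int n < W" "int K < W" "2 < W"
    using assms(6,7) bounds W_greater by linarith+
  have params: "vars \<sigma> Vn = int n" "vars \<sigma> VK = int K"
    using \<sigma>(1) by (simp_all add: at_entry_def params_def)
  consider (no_chain) "K \<le> ?k" | (row) "?k < K" "x < n" | (column) "?k < K" "n \<le> x" "x < 2 * n"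
    | (chain) "?k < K" "2 * n \<le> x"
    by linarith
  then show ?thesis
  proof cases
    case no_chain
    then show ?thesis using \<sigma> safe by (simp add: link_at_stm_def params link)
  next
    case row
    then have "wp W m row_stm (at_entry e H (link x y)) \<sigma>"
      using wp_row[OF \<sigma>(1,2,4,5) _ _ chain_position_less H] assms(8) by (simp add: link)
    then show ?thesis using row \<sigma> safe by (simp add: link_at_stm_def params)
  next
    case column
    then have "wp W m column_stm (at_entry e H (link x y)) \<sigma>"
      using wp_column[OF \<sigma>(1) _ \<sigma>(4,5) _ _ chain_position_less H, of "x - n"] assms(8) \<sigma>(2)
      by (simp add: link)
    then show ?thesis using column \<sigma> safe by (simp add: link_at_stm_def params)
  next
    case chain
    then have "wp W m chain_stm (at_entry e H (link x y)) \<sigma>"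
      using wp_chain[OF \<sigma>(1-3,5) assms(6,7) chain_position_less] assms(8) by (simp add: link)
    then show ?thesis using chain \<sigma> safe by (simp add: link_at_stm_def params)
  qed
qed

lemma wp_link:
  assumes "at_entry e H None \<sigma>" "vars \<sigma> Vx = int x" "vars \<sigma> Vy = int y" "x < N" "y < N"
    and H: "\<And>a. a < base \<Longrightarrow> H a = input_mem a"
  shows "wp W m link_stm (at_entry e H (link x y)) \<sigma>"
proof (cases "y < 2 * n")
  case True
  then have "link x y = None" by (simp add: link_def Let_def)
  then show ?thesis
    using assms(1-3) True unfolding link_stm_def
    by (simp add: at_entry_def params_def; intro conjI; use bounds assms(5) in linarith)
next
  case False
  let ?k = "chain_index y" and ?p = "chain_position y"
  have decoded: "(int y - 2 * int n) div (1 + 2 * int L) = int ?k"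
      "(int y - 2 * int n) mod (1 + 2 * int L) = int ?p"
    using False
    by (simp_all add: chain_index_def chain_position_def of_nat_div of_nat_mod of_nat_diff)
  have "?k \<le> y" unfolding chain_index_def by (metis diff_le_self div_le_dividend order_trans)
  moreover have "?p < S" by (rule chain_position_less)
  moreover have "wp W m link_at_stm (at_entry e H (link x y))
      (assign Vp (int ?p) (assign Vk (int ?k) \<sigma>))"
    by (rule wp_link_at) (use assms False in \<open>simp_all add: at_entry_def params_def\<close>)
  ultimately show ?thesis
    using assms(1-3) False unfolding link_stm_def
    by (simp add: at_entry_def[of e H None] params_def decoded;
        intro conjI; use bounds assms(5) in linarith)
qed

lemma flag_word_less: "\<bar>flag_word w\<bar> < W"
  using W_greater by (auto simp: flag_word_def split: option.split)

lemma weight_word_edge_less: "\<bar>weight_word (edge u v)\<bar> < W"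
proof (cases "edge u v")
  case None
  then show ?thesis using W_greater by (simp add: weight_word_def)
next
  case (Some w)
  then have "w \<le> 4 * K + 2 * D" using edge_weight_le by (fastforce simp: B_def)
  then have "int w \<le> 4 * int K + 2 * int D" by linarith
  then have "int w < W" using bounds by linarith
  with Some show ?thesis by (simp add: weight_word_def)
qed

lemma cell_less: "\<bar>cell c\<bar> < W"
  using flag_word_less weight_word_edge_less by (simp add: cell_def)

lemma wp_build:
  assumes "i < N * N" "params \<sigma>" "heap \<sigma> = built_mem i"
  shows "wp W m build_stm (\<lambda>\<sigma>. params \<sigma> \<and> heap \<sigma> = built_mem (Suc i)) (assign Ve (int i) \<sigma>)"
proof -
  let ?u = "i div N" and ?v = "i mod N" and ?\<sigma> = "assign Ve (int i) \<sigma>"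
  have uv: "?u < N" "?v < N"
    using assms(1) bounds(1,4) by (auto simp: less_mult_imp_div_less)
  have \<sigma>: "params ?\<sigma>" "vars ?\<sigma> Ve = int i" using assms(2) by (simp_all add: params_def)
  have input: "built_mem i a = input_mem a" if "a < base" for a
    using that by (simp add: built_mem_def)
  show ?thesis unfolding build_stm_def
  proof (rule wp_Comp[OF wp_endpoints[OF \<sigma> assms(1)]])
    fix \<sigma>' assume "at_entry i (heap ?\<sigma>) None \<sigma>' \<and>
      vars \<sigma>' Vx = int (min ?u ?v) \<and> vars \<sigma>' Vy = int (max ?u ?v)"
    then have "wp W m link_stm (at_entry i (built_mem i) (edge ?u ?v)) \<sigma>'"
      unfolding edge_def using uv assms(3) input by (intro wp_link) auto
    then show "wp W m (link_stm \<^bold>; write_stm) (\<lambda>\<sigma>. params \<sigma> \<and> heap \<sigma> = built_mem (Suc i)) \<sigma>'"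
    proof (rule wp_Comp)
      fix \<tau> assume "at_entry i (built_mem i) (edge ?u ?v) \<tau>"
      moreover have "flag_word (edge ?u ?v) = cell (2 * i)"
        "weight_word (edge ?u ?v) = cell (2 * i + 1)"
        by (simp_all add: cell_def)
      ultimately have \<tau>: "params \<tau>" "vars \<tau> Ve = int i" "heap \<tau> = built_mem i"
          "vars \<tau> Vb = cell (2 * i)" "vars \<tau> Vw = cell (2 * i + 1)"
        by (simp_all add: at_entry_def)
      have addr: "nat (2 * (int N * int N) + 1 + 2 * int i) = base + 2 * i"
          "nat (2 * (int N * int N) + 1 + 2 * int i + 1) = base + 2 * i + 1"
        using nat_base_add[of "2 * i"] nat_base_add[of "2 * i + 1"] by (simp_all add: algebra_simps)
      have "int i < int N * int N" using assms(1) by (simp flip: of_nat_mult)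
      then show "wp W m write_stm (\<lambda>\<sigma>. params \<sigma> \<and> heap \<sigma> = built_mem (Suc i)) \<tau>"
        using \<tau> cell_less[of "2 * i"] cell_less[of "2 * i + 1"] built_mem_Suc[of i]
        by (simp add: write_stm_def params_def addr addr[simplified];
            intro conjI; use bounds in linarith)
    qed
  qed
qed

lemma wp_move:
  assumes "i < 2 * (N * N)" "params \<sigma>" "heap \<sigma> = moved_mem i"
  shows "wp W m move_stm (\<lambda>\<sigma>. params \<sigma> \<and> heap \<sigma> = moved_mem (Suc i)) (assign Ve (int i) \<sigma>)"
proof -
  have i: "int i < 2 * (int N * int N)" using assms(1) by (simp flip: of_nat_mult)
  have addr: "nat (2 * (int N * int N) + 1 + int i) = base + i" "nat (int i + 1) = i + 1"
    using nat_base_add[of i] by (simp_all add: nat_add_distrib)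
  show ?thesis
    using assms(2,3) cell_less[of i] moved_mem_next[OF assms(1)] moved_mem_Suc[OF assms(1)]
    by (simp add: move_stm_def params_def addr addr[simplified];
        intro conjI; use bounds i in linarith)
qed

lemma wp_encode:
  assumes "heap \<sigma> = input_mem"
  shows "wp W (2 * (N * N)) encode_stm
    (\<lambda>\<sigma>. params \<sigma> \<and> heap \<sigma> = mem (init_state (apsp_input (graph, weight)))) \<sigma>"
  unfolding encode_stm_def
proof (rule wp_Comp[OF wp_setup[OF assms]], rule wp_Comp[rotated], rule wp_Comp[rotated])
  fix \<sigma> assume \<sigma>: "params \<sigma> \<and> heap \<sigma> = input_mem"
  show "wp W (2 * (N * N)) (For Ve (Var VE) build_stm)
      (\<lambda>\<sigma>. params \<sigma> \<and> heap \<sigma> = built_mem (N * N)) \<sigma>"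
  proof (rule wp_For[where I = "\<lambda>i \<sigma>. params \<sigma> \<and> heap \<sigma> = built_mem i"])
    show "asafe W (Var VE) \<sigma>" "aval (Var VE) \<sigma> = int (N * N)"
      using \<sigma> W_greater by (simp_all add: params_def)
  qed (use \<sigma> wp_build in \<open>auto simp: built_mem_0\<close>)
next
  fix \<sigma> assume \<sigma>: "params \<sigma> \<and> heap \<sigma> = built_mem (N * N)"
  show "wp W (2 * (N * N)) (For Ve (Num 2 \<^bold>* Var VE) move_stm)
      (\<lambda>\<sigma>. params \<sigma> \<and> heap \<sigma> = moved_mem (2 * (N * N))) \<sigma>"
  proof (rule wp_For[where I = "\<lambda>i \<sigma>. params \<sigma> \<and> heap \<sigma> = moved_mem i"])
    show "asafe W (Num 2 \<^bold>* Var VE) \<sigma>" "aval (Num 2 \<^bold>* Var VE) \<sigma> = int (2 * (N * N))"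
      using \<sigma> W_greater by (simp_all add: params_def)
  qed (use \<sigma> wp_move in \<open>auto simp: moved_mem_0\<close>)
next
  fix \<sigma> assume "params \<sigma> \<and> heap \<sigma> = moved_mem (2 * (N * N))"
  moreover have "int N < W" using bounds by linarith
  ultimately show "wp W (2 * (N * N)) (Write (Num 0) (Var VN))
      (\<lambda>\<sigma>. params \<sigma> \<and> heap \<sigma> = mem (init_state (apsp_input (graph, weight)))) \<sigma>"
    using moved_mem_all W_greater by (simp add: params_def)
qed

definition output_mem :: "(nat \<Rightarrow> int) \<Rightarrow> nat \<Rightarrow> nat \<Rightarrow> int" where
  "output_mem H i a = (if a < i then int (min_sum (a div n) (a mod n)) - 2 * int K else H a)"

lemma output_mem_0: "output_mem H 0 = H"
  by (simp add: output_mem_def fun_eq_iff)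

lemma output_mem_Suc:
  "(output_mem H i)(i := int (min_sum (i div n) (i mod n)) - 2 * int K) = output_mem H (Suc i)"
  by (auto simp: output_mem_def fun_eq_iff less_Suc_eq)

lemma min_sum_bound:
  assumes "i < n" "j < n"
  shows "min_sum i j \<le> 4 * K"
  using min_sum_le[OF K_pos, of i j] \<alpha>_le[OF assms(1) K_pos] \<beta>_le[OF K_pos assms(2)]
  by (simp add: B_def)

lemma distance_address_less:
  assumes "i < n" "j < n"
  shows "2 * (int i * int N + (int n + int j)) + 1 < W"
proof -
  have "i * N + N \<le> N * N"
    using mult_le_mono1[of "Suc i" N N] assms(1) by (simp add: N_def)
  then have "int i * int N + int N \<le> int N * int N" by (simp flip: of_nat_mult of_nat_add)
  moreover have "int j < int n" using assms(2) by simp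
  ultimately have "int i * int N + (int n + int j) < int N * int N" using bounds by linarith
  moreover have "2 * a + 1 < W" if "a < int N * int N" for a using that bounds by linarith
  ultimately show ?thesis by blast
qed

lemma wp_read:
  assumes "i < n * n" "params \<sigma>" "heap \<sigma> = output_mem H i"
    and H: "\<And>i j. i < n \<Longrightarrow> j < n \<Longrightarrow> H (2 * (i * N + (n + j)) + 1) = int (2 * M + min_sum i j)"
  shows "wp W m read_stm (\<lambda>\<sigma>. params \<sigma> \<and> heap \<sigma> = output_mem H (Suc i)) (assign Ve (int i) \<sigma>)"
proof -
  define u v where "u = i div n" and "v = i mod n"
  have uv: "u < n" "v < n"
    using assms(1) K by (auto simp: u_def v_def less_mult_imp_div_less)
  have i: "i = u * n + v" by (simp add: u_def v_def)
  have div_mod: "int i div int n = int u" "int i mod int n = int v"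
    by (simp_all add: u_def v_def of_nat_div of_nat_mod)
  let ?a = "2 * (u * N + (n + v)) + 1"
  have addr: "nat (2 * (int u * int N + (int n + int v)) + 1) = ?a"
    by (simp add: nat_add_distrib nat_mult_distrib)
  have "i < ?a" unfolding i N_def by simp
  then have cell: "heap \<sigma> ?a = int (2 * M + min_sum u v)"
    using assms(3) H[OF uv] by (simp add: output_mem_def)
  have "int (min_sum u v) \<le> 4 * int K" using min_sum_bound[OF uv] by simp
  moreover have "int i < int n * int n" using assms(1) by (simp flip: of_nat_mult)
  moreover have "0 \<le> int u * int N" "int u * int N \<le> int N * int N" "int u < int n" "int v < int n"
    using uv by (simp_all add: N_def mult_right_mono)
  moreover have "(output_mem H i)(i := int (min_sum u v) - 2 * int K) = output_mem H (Suc i)"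
    using output_mem_Suc unfolding u_def v_def .
  ultimately show ?thesis
    using assms(2,3) cell
    by (simp add: read_stm_def params_def div_mod addr addr[simplified] cell[simplified]
          del: distrib_left_numeral;
        intro conjI; use bounds distance_address_less[OF uv] in linarith)
qed

lemma wp_decode:
  assumes "params \<sigma>" "apsp_correct (graph, weight) (heap \<sigma>)"
  shows "wp W (2 * (N * N)) decode_stm (\<lambda>\<sigma>. min_plus_correct (X, Y) (heap \<sigma>)) \<sigma>"
proof -
  let ?H = "heap \<sigma>"
  have distances: "?H (2 * (i * N + (n + j)) + 1) = int (2 * M + min_sum i j)"
    if "i < n" "j < n" for i j
  proof -
    have "i < N" "n + j < N" using that by (simp_all add: N_def)
    moreover have "card (pverts graph) = N" by (simp add: graph_def)
    ultimately have "decode_distance (?H (2 * (i * N + (n + j)))) (?H (2 * (i * N + (n + j)) + 1))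
        (distance graph weight i (n + j))"
      using assms(2) unfolding apsp_correct.simps Let_def by metis
    then show ?thesis unfolding distance_row_column[OF that] decode_distance_def by auto
  qed
  have dims_less: "int n < W" "int n * int n < W" using bounds by linarith+
  have "wp W (2 * (N * N)) decode_stm (\<lambda>\<sigma>. params \<sigma> \<and> heap \<sigma> = output_mem ?H (n * n)) \<sigma>"
    unfolding decode_stm_def
  proof (rule wp_For[where I = "\<lambda>i \<sigma>. params \<sigma> \<and> heap \<sigma> = output_mem ?H i"])
    show "n * n \<le> 2 * (N * N)" by (simp add: N_def)
    show "wp W (2 * (N * N)) read_stm
        (\<lambda>\<sigma>. params \<sigma> \<and> heap \<sigma> = output_mem ?H (Suc i)) (assign Ve (int i) \<tau>)"
      if "i < n * n" "params \<tau> \<and> heap \<tau> = output_mem ?H i" for i \<tau>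
      using that distances by (intro wp_read) auto
  qed (use assms(1) dims_less in \<open>simp_all add: params_def output_mem_0\<close>)
  then show ?thesis
  proof (rule wp_mono)
    fix \<tau> assume "params \<tau> \<and> heap \<tau> = output_mem ?H (n * n)"
    then show "min_plus_correct (X, Y) (heap \<tau>)"
      using X Y min_plus_product_eq mult_add_less[of _ n _ n] by (simp add: output_mem_def)
  qed
qed

theorem reduces_to_apsp:
  "reduces_instance W (2 * (N * N)) encode_stm decode_stm
    (min_plus_input (X, Y)) (min_plus_correct (X, Y))
    (apsp_input (graph, weight)) (apsp_correct (graph, weight))"
  unfolding reduces_instance_def
proof (intro allI impI)
  fix \<sigma> :: "var store" assume "heap \<sigma> = mem (init_state (min_plus_input (X, Y)))"
  then have "heap \<sigma> = input_mem" by (simp only: input_mem_def)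
  then show "wp W (2 * (N * N)) encode_stm
      (\<lambda>\<sigma>. heap \<sigma> = mem (init_state (apsp_input (graph, weight))) \<and>
        (\<forall>H. apsp_correct (graph, weight) H \<longrightarrow>
          wp W (2 * (N * N)) decode_stm (\<lambda>\<sigma>. min_plus_correct (X, Y) (heap \<sigma>)) (\<sigma>\<lparr>heap := H\<rparr>))) \<sigma>"
  proof (rule wp_mono[OF wp_encode])
    fix \<sigma> assume \<sigma>: "params \<sigma> \<and> heap \<sigma> = mem (init_state (apsp_input (graph, weight)))"
    have "wp W (2 * (N * N)) decode_stm (\<lambda>\<sigma>. min_plus_correct (X, Y) (heap \<sigma>)) (\<sigma>\<lparr>heap := H\<rparr>)"
      if "apsp_correct (graph, weight) H" for H
    proof (rule wp_decode)
      show "params (\<sigma>\<lparr>heap := H\<rparr>)" using \<sigma> by (simp add: params_def)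
      show "apsp_correct (graph, weight) (heap (\<sigma>\<lparr>heap := H\<rparr>))"
        using that by simp
    qed
    with \<sigma> show "heap \<sigma> = mem (init_state (apsp_input (graph, weight))) \<and>
        (\<forall>H. apsp_correct (graph, weight) H \<longrightarrow>
          wp W (2 * (N * N)) decode_stm (\<lambda>\<sigma>. min_plus_correct (X, Y) (heap \<sigma>)) (\<sigma>\<lparr>heap := H\<rparr>))"
      by blast
  qed
qed

end

end

section \<open>The lower bound\<close>

lemma apsp_time_le:
  fixes \<gamma> \<epsilon> \<epsilon>' :: real and n c :: nat
  assumes "0 \<le> \<gamma>" "1 \<le> n" "1 \<le> c" "\<epsilon>' \<le> \<epsilon>"
  shows "sqrt (num_weights \<gamma> (c * n)) * real (c * n) powr (5/2 - \<epsilon>)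
    \<le> sqrt 2 * real c powr (2 + (1 + \<gamma>) / 2 - \<epsilon>) * real n powr (2 + (1 + \<gamma>) / 2 - \<epsilon>')"
proof -
  let ?N = "real (c * n)"
  have N: "1 \<le> ?N" using assms(2,3) by (simp del: of_nat_mult)
  have "1 \<le> ?N powr \<gamma>" using N assms(1) by (rule ge_one_powr_ge_zero)
  then have "num_weights \<gamma> (c * n) \<le> 2 * ?N powr \<gamma>" unfolding num_weights_def by simp
  then have "sqrt (num_weights \<gamma> (c * n)) \<le> sqrt (2 * ?N powr \<gamma>)" by (rule real_sqrt_le_mono)
  also have "\<dots> = sqrt 2 * ?N powr (\<gamma> / 2)"
    by (simp add: real_sqrt_mult powr_half_sqrt[symmetric] powr_powr)
  finally have "sqrt (num_weights \<gamma> (c * n)) * ?N powr (5/2 - \<epsilon>)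
      \<le> sqrt 2 * ?N powr (\<gamma> / 2) * ?N powr (5/2 - \<epsilon>)"
    by (rule mult_right_mono) simp
  also have "\<dots> = sqrt 2 * ?N powr (2 + (1 + \<gamma>) / 2 - \<epsilon>)"
    by (simp add: mult.assoc powr_add[symmetric] field_simps del: of_nat_mult)
  also have "\<dots> = sqrt 2 * real c powr (2 + (1 + \<gamma>) / 2 - \<epsilon>) * real n powr (2 + (1 + \<gamma>) / 2 - \<epsilon>)"
    by (simp add: powr_mult)
  also have "\<dots> \<le> sqrt 2 * real c powr (2 + (1 + \<gamma>) / 2 - \<epsilon>) * real n powr (2 + (1 + \<gamma>) / 2 - \<epsilon>')"
    using assms(2,4) by (intro mult_left_mono powr_mono) auto
  finally show ?thesis .
qed

lemma block_size_le_num_weights: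
  fixes \<gamma> :: real
  assumes "0 \<le> \<gamma>" "1 \<le> n" "n \<le> m" "real K \<le> real n powr ((1 + \<gamma>) / 2)"
  shows "real (block_size n K + 1) \<le> num_weights \<gamma> m"
proof -
  have "real (K * K div n) \<le> real (K * K) / real n" by (rule of_nat_div_le_of_nat)
  also have "\<dots> \<le> (real n powr ((1 + \<gamma>) / 2) * real n powr ((1 + \<gamma>) / 2)) / real n"
    unfolding of_nat_mult using assms by (intro divide_right_mono mult_mono) auto
  also have "real n powr ((1 + \<gamma>) / 2) * real n powr ((1 + \<gamma>) / 2) = real n * real n powr \<gamma>"
    using assms(2) by (simp add: powr_add[symmetric]) (simp add: powr_add)
  also have "real n * real n powr \<gamma> / real n = real n powr \<gamma>" using assms(2) by simp
  also have "\<dots> \<le> real m powr \<gamma>" using assms by (intro powr_mono2) auto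
  finally show ?thesis unfolding num_weights_def block_size_def by (auto simp: max_def)
qed

lemma graph_order_square_less:
  assumes "(int n + 2) ^ 9 \<le> W" "1 \<le> n"
  shows "6 * (int (15 * n) * int (15 * n)) < W"
proof -
  let ?x = "int n + 2"
  have "6 * (int (15 * n) * int (15 * n)) < 3 ^ 7 * ?x ^ 2"
    by (simp add: power2_eq_square algebra_simps add_pos_nonneg)
  also have "\<dots> \<le> ?x ^ 7 * ?x ^ 2"
    using assms(2) by (intro mult_right_mono power_mono) auto
  also have "\<dots> = ?x ^ 9" by (simp flip: power_add)
  finally show ?thesis using assms(1) by simp
qed

lemma graph_order_le_power:
  assumes "1 \<le> n"
  shows "int (15 * n) + 2 \<le> (int n + 2) ^ 4"
proof -
  let ?x = "int n + 2"
  have "int (15 * n) + 2 \<le> 3 ^ 3 * ?x" by simp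
  also have "\<dots> \<le> ?x ^ 3 * ?x" using assms by (intro mult_right_mono power_mono) auto
  also have "\<dots> = ?x ^ 4" by (simp add: power_Suc2[symmetric] del: power_Suc)
  finally show ?thesis .
qed

lemma loop_depth_encode_decode: "loop_depth encode_stm \<le> 1" "loop_depth decode_stm \<le> 1"
  by (simp_all add: encode_stm_def decode_stm_def setup_stm_def build_stm_def endpoints_stm_def
      link_stm_def link_at_stm_def row_stm_def column_stm_def chain_stm_def entry_stm_def
      attach_stm_def write_stm_def move_stm_def read_stm_def)

lemma min_plus_instanceI:
  fixes \<delta> :: real
  assumes "1 \<le> n" "0 \<le> \<delta>" "\<delta> \<le> 1"
    and "(X, Y) \<in> min_plus_instances n (nat \<lfloor>real n powr \<delta>\<rfloor>) n (real n powr \<delta>)"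
  shows "min_plus_instance n (nat \<lfloor>real n powr \<delta>\<rfloor>) X Y"
proof
  have "1 \<le> real n powr \<delta>" using assms by (simp add: ge_one_powr_ge_zero)
  moreover have "real n powr \<delta> \<le> real n powr 1" using assms by (intro powr_mono) auto
  ultimately show "0 < nat \<lfloor>real n powr \<delta>\<rfloor>" "nat \<lfloor>real n powr \<delta>\<rfloor> \<le> n"
    using assms(1) by (simp_all add: nat_le_iff floor_le_iff)
  have entry: "\<bar>z\<bar> \<le> int (nat \<lfloor>real n powr \<delta>\<rfloor>)" if "real_of_int \<bar>z\<bar> \<le> real n powr \<delta>" for z
  proof -
    have "\<bar>z\<bar> \<le> \<lfloor>real n powr \<delta>\<rfloor>" using that by (simp add: le_floor_iff)
    then show ?thesis by linarith
  qed
  show "\<bar>X $$ (i, k)\<bar> \<le> int (nat \<lfloor>real n powr \<delta>\<rfloor>)"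
    if "i < n" "k < nat \<lfloor>real n powr \<delta>\<rfloor>" for i k
    using assms(4) that by (intro entry) (auto simp: min_plus_instances_def)
  show "\<bar>Y $$ (k, j)\<bar> \<le> int (nat \<lfloor>real n powr \<delta>\<rfloor>)"
    if "k < nat \<lfloor>real n powr \<delta>\<rfloor>" "j < n" for k j
    using assms(4) that by (intro entry) (auto simp: min_plus_instances_def)
qed (use assms(4) in \<open>simp_all add: min_plus_instances_def\<close>)

lemma (in min_plus_instance) graph_instance:
  fixes \<gamma> :: real
  assumes "0 \<le> \<gamma>" "real K \<le> real n powr ((1 + \<gamma>) / 2)"
  shows "(graph, weight) \<in> {(G, w) \<in> undirected_graphs N \<inter> few_weights (num_weights \<gamma> N).
    \<forall>e\<in>parcs G. \<bar>w e\<bar> \<le> int N ^ 1}"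
proof -
  have "real (card (weight ` parcs graph)) \<le> real (D + 1)" using card_weights_le by simp
  also have "\<dots> \<le> num_weights \<gamma> N"
    unfolding D_def using assms K by (intro block_size_le_num_weights) (auto simp: N_def)
  finally have "(graph, weight) \<in> few_weights (num_weights \<gamma> N)" by (simp add: few_weights_def)
  moreover have "\<bar>weight e\<bar> \<le> int N ^ 1" if e: "e \<in> parcs graph" for e
  proof -
    obtain u v w where uv: "e = (u, v)" "edge u v = Some w" using e by (auto simp: graph_def)
    then have "w \<le> 2 * (B + D)" by (intro edge_weight_le) auto
    also have "\<dots> \<le> N" using D_le K by (simp add: B_def N_def)
    finally show ?thesis using uv by (simp add: weight_def)
  qed
  ultimately show ?thesis using graph_undirected by simp
qed

theorem min_plus_solvable_if_apsp_solvable: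
  fixes \<gamma> \<epsilon> :: real
  assumes "0 \<le> \<gamma>" "\<gamma> \<le> 1"
    and apsp: "apsp_solvable_in_time
      (\<lambda>n. undirected_graphs n \<inter> few_weights (num_weights \<gamma> n))
      (\<lambda>n. sqrt (num_weights \<gamma> n) * real n powr (5/2 - \<epsilon>))"
  defines "\<delta> \<equiv> (1 + \<gamma>) / 2"
  shows "solvable_in_time
    (\<lambda>n. min_plus_instances n (nat \<lfloor>real n powr \<delta>\<rfloor>) n (real n powr \<delta>))
    min_plus_input min_plus_correct (\<lambda>n. real n powr (2 + \<delta> - min \<epsilon> (1/2)))"
proof (rule solvable_in_time_reduction)
  let ?inst' = "\<lambda>n. {(G, w) \<in> undirected_graphs n \<inter> few_weights (num_weights \<gamma> n).
    \<forall>e\<in>parcs G. \<bar>w e\<bar> \<le> int n ^ 1}"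
  show "solvable_in_time ?inst' apsp_input apsp_correct
      (\<lambda>n. sqrt (num_weights \<gamma> n) * real n powr (5/2 - \<epsilon>))"
    using apsp unfolding apsp_solvable_in_time_def by blast
  fix n :: nat assume n: "1 \<le> n"
  show "1 \<le> 15 * n \<and> int (15 * n) + 2 \<le> (int n + 2) ^ 4"
    using n by (intro conjI graph_order_le_power) simp_all
  show "1 \<le> 2 * (15 * n * (15 * n)) \<and>
      real ((2 * (15 * n * (15 * n))) ^ 1) \<le> 450 * real n powr (2 + \<delta> - min \<epsilon> (1/2))"
  proof -
    have "real n powr 2 \<le> real n powr (2 + \<delta> - min \<epsilon> (1/2))"
      using n assms(1) by (intro powr_mono) (auto simp: \<delta>_def)
    then show ?thesis using n by (simp add: power2_eq_square)
  qed
  show "0 \<le> sqrt (num_weights \<gamma> (15 * n)) * real (15 * n) powr (5/2 - \<epsilon>) \<and>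
      sqrt (num_weights \<gamma> (15 * n)) * real (15 * n) powr (5/2 - \<epsilon>)
        \<le> sqrt 2 * real 15 powr (2 + \<delta> - \<epsilon>) * real n powr (2 + \<delta> - min \<epsilon> (1/2))"
    unfolding \<delta>_def using assms(1) n by (intro conjI apsp_time_le) (simp_all add: num_weights_def)
  fix x and W :: int
  assume x: "x \<in> min_plus_instances n (nat \<lfloor>real n powr \<delta>\<rfloor>) n (real n powr \<delta>)"
    and W: "(int n + 2) ^ 9 \<le> W"
  obtain X Y where XY: "x = (X, Y)" by fastforce
  interpret min_plus_instance n "nat \<lfloor>real n powr \<delta>\<rfloor>" X Y
    using n assms(1,2) x by (intro min_plus_instanceI) (auto simp: \<delta>_def XY)
  have "real (nat \<lfloor>real n powr \<delta>\<rfloor>) \<le> real n powr \<delta>" by simp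
  then have "(graph, weight) \<in> ?inst' (15 * n)"
    using graph_instance[OF assms(1)] unfolding N_def \<delta>_def by blast
  moreover have "reduces_instance W (2 * (15 * n * (15 * n))) encode_stm decode_stm
      (min_plus_input x) (min_plus_correct x)
      (apsp_input (graph, weight)) (apsp_correct (graph, weight))"
    using reduces_to_apsp graph_order_square_less[OF W n] unfolding XY N_def by blast
  ultimately show "\<exists>y\<in>?inst' (15 * n). reduces_instance W (2 * (15 * n * (15 * n)))
      encode_stm decode_stm (min_plus_input x) (min_plus_correct x) (apsp_input y) (apsp_correct y)"
    by blast
qed (rule loop_depth_encode_decode)+

lemma solvable_in_time_subset:
  assumes "solvable_in_time inst inp correct T" "\<And>n. inst' n \<subseteq> inst n"
  shows "solvable_in_time inst' inp correct T"
  using assms(1) unfolding solvable_in_time_def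
  by (elim ex_forward all_forward imp_forward) (use assms(2) in \<open>auto simp: subset_iff\<close>)

lemma apsp_solvable_in_time_subset:
  assumes "apsp_solvable_in_time \<G> T" "\<And>n. \<H> n \<subseteq> \<G> n"
  shows "apsp_solvable_in_time \<H> T"
  unfolding apsp_solvable_in_time_def
proof
  fix c
  have "solvable_in_time (\<lambda>n. {(G, w) \<in> \<G> n. \<forall>e\<in>parcs G. \<bar>w e\<bar> \<le> int n ^ c})
      apsp_input apsp_correct T"
    using assms(1) by (simp add: apsp_solvable_in_time_def)
  then show "solvable_in_time (\<lambda>n. {(G, w) \<in> \<H> n. \<forall>e\<in>parcs G. \<bar>w e\<bar> \<le> int n ^ c})
      apsp_input apsp_correct T"
    by (rule solvable_in_time_subset) (use assms(2) in blast)
qed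

lemma few_weights_subset_per_node:
  "directed_graphs n \<inter> few_weights d \<subseteq> few_weights_per_node d"
proof safe
  fix G w assume G: "(G, w) \<in> directed_graphs n" "(G, w) \<in> few_weights d"
  then interpret pair_digraph G by (simp add: directed_graphs_def)
  have "card (w ` out_arcs (with_proj G) u) \<le> card (w ` parcs G)" for u
    using pair_finite_arcs by (intro card_mono image_mono) (auto simp: out_arcs_def)
  then show "(G, w) \<in> few_weights_per_node d"
    using G(2) unfolding few_weights_def few_weights_per_node_def
    by (auto intro: order_trans[OF of_nat_mono])
qed

theorem theorem1p6:
  fixes \<gamma> \<epsilon> :: real
  assumes "bounded_min_plus_hypothesis"
    and "0 \<le> \<gamma>" and "\<gamma> \<le> 1"
    and "\<epsilon> > 0"
  shows "\<not> apsp_solvable_in_time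
            (\<lambda>n. directed_graphs n \<inter> few_weights (num_weights \<gamma> n))
            (\<lambda>n. sqrt (num_weights \<gamma> n) * real n powr (5/2 - \<epsilon>))
       \<and> \<not> apsp_solvable_in_time
            (\<lambda>n. undirected_graphs n \<inter> few_weights (num_weights \<gamma> n))
            (\<lambda>n. sqrt (num_weights \<gamma> n) * real n powr (5/2 - \<epsilon>))
       \<and> \<not> apsp_solvable_in_time
            (\<lambda>n. directed_graphs n \<inter> few_weights_per_node (num_weights \<gamma> n))
            (\<lambda>n. sqrt (num_weights \<gamma> n) * real n powr (5/2 - \<epsilon>))"
proof -
  let ?T = "\<lambda>n. sqrt (num_weights \<gamma> n) * real n powr (5/2 - \<epsilon>)"
  let ?U = "\<lambda>n. undirected_graphs n \<inter> few_weights (num_weights \<gamma> n)"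
  have undirected: "\<not> apsp_solvable_in_time ?U ?T"
  proof
    assume "apsp_solvable_in_time ?U ?T"
    note min_plus_solvable_if_apsp_solvable[OF assms(2,3) this]
    moreover have "(1 + \<gamma>) / 2 \<in> {1/2..1}" "0 < min \<epsilon> (1/2)" using assms by auto
    ultimately show False using assms(1) unfolding bounded_min_plus_hypothesis_def by blast
  qed
  have directed: "?U n \<subseteq> directed_graphs n \<inter> few_weights (num_weights \<gamma> n)" for n
    by (auto simp: undirected_graphs_def)
  then have per_node: "?U n \<subseteq> directed_graphs n \<inter> few_weights_per_node (num_weights \<gamma> n)" for n
    using few_weights_subset_per_node by blast
  show ?thesis
    using undirected apsp_solvable_in_time_subset[where \<H> = ?U, OF _ directed]
      apsp_solvable_in_time_subset[where \<H> = ?U, OF _ per_node] by auto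
qed

end
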